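(* Let $d$ be a positive integer such that a SIC exists in dimension $d$, and let $\Phi_{\rm SIC}$ be the matrix associated with a SIC reference process in dimension $d$. Let $\{H_i\}_{i=1}^{d^2}$ be a MIC in dimension $d$, let $\{\sigma_j\}_{j=1}^{d^2}$ be a linearly independent set of density operators on $\mathbb{C}^d$ (post-measurement states), and let $\Phi$ be the $d^2\times d^2$ column-quasistochastic matrix associated with this arbitrary reference process, defined by $[\Phi^{-1}]_{ij}=\operatorname{tr}(H_i\sigma_j)$. Then for any unitarily invariant norm $\|\cdot\|$, $$\|I-\Phi\|\ \geq\ \|I-\Phi_{\rm SIC}\|,$$ with equality if and only if the MIC and the post-measurement states are the same SIC, i.e. $\{H_i\}$ is a SIC and $\sigma_i=d\,H_i$ for all $i$.
   Context: A MIC (minimal informationally complete POVM) in dimension $d$ is a family $\{H_i\}_{i=1}^{d^2}$ of positive semidefinite operators on $\mathbb{C}^d$ with $\sum_i H_i=I$ that is a basis of the real vector space of Hermitian operators on $\mathbb{C}^d$. A density operator is a positive semidefinite operator of trace $1$. A reference process consists of a MIC $\{H_i\}$ together with a linearly independent set of $d^2$ density operators $\{\sigma_j\}$ (the state $\sigma_i$ is prepared upon obtaining outcome $i$ of the MIC). The linear independence of $\{H_i\}$ and $\{\sigma_j\}$ guarantees that the matrix $[\operatorname{tr} H_i\sigma_j]_{ij}$ is invertible, so $\Phi$ (its inverse) is well defined. A real matrix is column-quasistochastic if each of its columns sums to $1$. A SIC in dimension $d$ is a MIC $\{H_i\}_{i=1}^{d^2}$ for which every $H_i$ has rank $1$ and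 $\operatorname{tr} H_iH_j=\frac{1}{d^2}\,\frac{d\,\delta_{ij}+1}{d+1}$ for all $i,j$. SICs have not been proven to exist in all finite dimensions. $\Phi_{\rm SIC}$ denotes the matrix $\Phi$ of the reference process in which $\{H_i\}$ is a SIC and $\sigma_i=dH_i$ for all $i$ (measurement and post-measurement states are the same SIC). It does not depend on the choice of SIC: $[\Phi_{\rm SIC}]_{ij}=(d+1)\delta_{ij}-\frac1d$. A norm on $d^2\times d^2$ matrices is unitarily invariant if $\|UAV\|=\|A\|$ for all matrices $A$ and all unitary matrices $U,V$. *)

theory Defs
  imports "HOL-Analysis.Analysis"
begin

text \<open>
  The dimension is d = \<open>CARD('n)\<close>, operators on $\mathbb{C}^d$ are matrices of type
  \<open>complex^'n^'n\<close>, and families of d^2 operators are functions on an index type \<open>'m\<close> with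
  \<open>CARD('m) = CARD('n)\<^sup>2\<close>. In this type \<open>independent\<close> and \<open>span\<close> refer to the structure
  of a \<^emph>\<open>real\<close> vector space.
\<close>

definition conj_transpose :: "complex^'n^'m \<Rightarrow> complex^'m^'n" where
  "conj_transpose A = (\<chi> i j. cnj (A $ j $ i))"

definition hermitian :: "complex^'n^'n \<Rightarrow> bool" where
  "hermitian A \<longleftrightarrow> conj_transpose A = A"

text \<open>Since \<open>A\<close> is required to be Hermitian, the quadratic form below is automatically real.\<close>

definition positive_semidefinite :: "complex^'n^'n \<Rightarrow> bool" where
  "positive_semidefinite A \<longleftrightarrow>
     hermitian A \<and> (\<forall>v. 0 \<le> Re (\<Sum>i\<in>UNIV. cnj (v $ i) * (A *v v) $ i))"

definition unitary :: "complex^'n^'n \<Rightarrow> bool" where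
  "unitary U \<longleftrightarrow> conj_transpose U ** U = mat 1 \<and> U ** conj_transpose U = mat 1"

definition density_operator :: "complex^'n^'n \<Rightarrow> bool" where
  "density_operator \<rho> \<longleftrightarrow> positive_semidefinite \<rho> \<and> trace \<rho> = 1"

text \<open>Linear independence and bases are properties of families, hence the injectivity.\<close>

definition independent_family :: "('m \<Rightarrow> complex^'n^'n) \<Rightarrow> bool" where
  "independent_family F \<longleftrightarrow> inj F \<and> independent (range F)"

definition mic :: "('m::finite \<Rightarrow> complex^'n^'n) \<Rightarrow> bool" where
  "mic H \<longleftrightarrow>
     CARD('m) = CARD('n)\<^sup>2 \<and>
     (\<forall>i. positive_semidefinite (H i)) \<and>
     (\<Sum>i\<in>UNIV. H i) = mat 1 \<and>
     independent_family H \<and> span (range H) = {A. hermitian A}"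

definition sic :: "('m::finite \<Rightarrow> complex^'n^'n) \<Rightarrow> bool" where
  "sic H \<longleftrightarrow>
     mic H \<and>
     (\<forall>i. rank (H i) = 1) \<and>
     (\<forall>i j. trace (H i ** H j) =
        1 / (of_nat CARD('n))\<^sup>2 *
        ((of_nat CARD('n) * (if i = j then 1 else 0) + 1) / (of_nat CARD('n) + 1)))"

definition reference_process ::
    "('m::finite \<Rightarrow> complex^'n^'n) \<Rightarrow> ('m \<Rightarrow> complex^'n^'n) \<Rightarrow> bool" where
  "reference_process H \<sigma> \<longleftrightarrow>
     mic H \<and> (\<forall>j. density_operator (\<sigma> j)) \<and> independent_family \<sigma>"

definition overlap_matrix ::
    "('m::finite \<Rightarrow> complex^'n^'n) \<Rightarrow> ('m \<Rightarrow> complex^'n^'n) \<Rightarrow> complex^'m^'m" where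
  "overlap_matrix H \<sigma> = (\<chi> i j. trace (H i ** \<sigma> j))"

text \<open>
  The entries of this matrix are real; it is taken over the complex numbers because unitarily
  invariant norms live on complex matrices.
\<close>

definition process_matrix ::
    "('m::finite \<Rightarrow> complex^'n^'n) \<Rightarrow> ('m \<Rightarrow> complex^'n^'n) \<Rightarrow> complex^'m^'m" where
  "process_matrix H \<sigma> = matrix_inv (overlap_matrix H \<sigma>)"

definition column_quasistochastic :: "complex^'m^'m \<Rightarrow> bool" where
  "column_quasistochastic A \<longleftrightarrow>
     (\<forall>i j. A $ i $ j \<in> \<real>) \<and> (\<forall>j. (\<Sum>i\<in>UNIV. A $ i $ j) = 1)"

text \<open>
  The overlap matrix of a reference process is invertible, so that \<open>process_matrix\<close> is a genuine
  inverse, and its inverse is column-quasistochastic.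
\<close>

lemma hermitian_cnj: "hermitian A \<Longrightarrow> cnj (A $ i $ j) = A $ j $ i"
  by (simp add: hermitian_def conj_transpose_def vec_eq_iff)

lemma trace_hermitian_square:
  fixes A :: "complex^'n^'n"
  assumes "hermitian A" "trace (A ** A) = 0"
  shows "A = 0"
proof -
  have "A $ i $ j * A $ j $ i = of_real ((cmod (A $ i $ j))\<^sup>2)" for i j
    using hermitian_cnj[OF assms(1), of i j] complex_norm_square[of "A $ i $ j"] by simp
  then have "trace (A ** A) = of_real (\<Sum>i\<in>UNIV. \<Sum>j\<in>UNIV. (cmod (A $ i $ j))\<^sup>2)"
    unfolding trace_def matrix_matrix_mult_def by simp
  then have "complex_of_real (\<Sum>i\<in>UNIV. \<Sum>j\<in>UNIV. (cmod (A $ i $ j))\<^sup>2) = 0"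
    using assms(2) by (rule trans[OF sym])
  then have z: "(\<Sum>i\<in>UNIV. \<Sum>j\<in>UNIV. (cmod (A $ i $ j))\<^sup>2) = 0"
    by (rule of_real_eq_0_iff[THEN iffD1])
  have "A $ i $ j = 0" for i j
  proof -
    have r: "(\<Sum>j\<in>UNIV. (cmod (A $ i $ j))\<^sup>2) = 0"
      by (rule sum_nonneg_0[OF _ _ z]) (auto intro: sum_nonneg)
    have "(cmod (A $ i $ j))\<^sup>2 = 0"
      by (rule sum_nonneg_0[OF _ _ r]) auto
    then show ?thesis by simp
  qed
  then show ?thesis by (simp add: vec_eq_iff)
qed

lemma hermitian_density: "density_operator \<rho> \<Longrightarrow> hermitian \<rho>"
  by (simp add: density_operator_def positive_semidefinite_def)

lemma hermitian_sum_scaleR: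
  assumes "\<And>j. hermitian (F j)"
  shows "hermitian (\<Sum>j\<in>J. r j *\<^sub>R F j)"
  using assms by (simp add: hermitian_def conj_transpose_def vec_eq_iff)

lemma cnj_trace_hermitian:
  fixes A B :: "complex^'n^'n"
  assumes "hermitian A" "hermitian B"
  shows "cnj (trace (A ** B)) = trace (A ** B)"
proof -
  have "cnj (trace (A ** B)) = trace (B ** A)"
    unfolding trace_def matrix_matrix_mult_def by (simp add: hermitian_cnj assms mult.commute)
  also have "\<dots> = trace (A ** B)" by (rule trace_mul_sym)
  finally show ?thesis .
qed

lemma trace_mult_sum_scaleR:
  fixes A :: "complex^'n^'n"
  shows "trace (A ** (\<Sum>j\<in>J. r j *\<^sub>R F j)) = (\<Sum>j\<in>J. r j *\<^sub>R trace (A ** F j))"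
proof (induction J rule: infinite_finite_induct)
  case (insert x J)
  have "trace (A ** (r x *\<^sub>R F x)) = r x *\<^sub>R trace (A ** F x)"
    by (simp add: trace_def matrix_matrix_mult_def scaleR_right.sum)
  then show ?case using insert by (simp add: matrix_add_ldistrib trace_add)
qed (simp_all add: trace_def)

lemma mic_trace_zero:
  fixes H :: "'m::finite \<Rightarrow> complex^'n^'n"
  assumes "mic H" "hermitian A" "\<And>i. trace (H i ** A) = 0"
  shows "A = 0"
proof -
  have "A \<in> span (range H)" using assms(1,2) by (simp add: mic_def)
  then have "trace (A ** B) = 0" if "\<forall>i. trace (H i ** B) = 0" for B
    using that
  proof (induction rule: span_induct_alt)
    case base
    then show ?case by (simp add: trace_def)
  next
    case (step c x y)
    have "trace ((c *\<^sub>R x) ** B) = c *\<^sub>R trace (x ** B)"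
      by (simp add: trace_def matrix_matrix_mult_def scaleR_right.sum)
    moreover have "trace ((c *\<^sub>R x + y) ** B) = trace ((c *\<^sub>R x) ** B) + trace (y ** B)"
      by (simp add: trace_def matrix_matrix_mult_def distrib_right sum.distrib)
    ultimately show ?case using step by auto
  qed
  then show ?thesis using assms(2,3) trace_hermitian_square by blast
qed

lemma overlap_matrix_invertible:
  fixes H \<sigma> :: "'m::finite \<Rightarrow> complex^'n^'n"
  assumes "reference_process H \<sigma>"
  shows "invertible (overlap_matrix H \<sigma>)"
proof -
  let ?M = "overlap_matrix H \<sigma>"
  have mic: "mic H" and hs: "\<And>j. hermitian (\<sigma> j)" and ind: "independent_family \<sigma>"
    using assms hermitian_density by (auto simp: reference_process_def)
  have hH: "\<And>i. hermitian (H i)"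
    using mic by (auto simp: mic_def positive_semidefinite_def)
  have real_ker: "r j = 0" if r: "\<And>i. (\<Sum>j\<in>UNIV. r j *\<^sub>R trace (H i ** \<sigma> j)) = 0" for r j
  proof -
    have "(\<Sum>j\<in>UNIV. r j *\<^sub>R \<sigma> j) = 0"
      using mic hs r by (intro mic_trace_zero hermitian_sum_scaleR) (auto simp: trace_mult_sum_scaleR)
    then have "(\<Sum>v\<in>range \<sigma>. r (inv \<sigma> v) *\<^sub>R v) = 0"
      using ind by (simp add: sum.reindex independent_family_def)
    then have "r (inv \<sigma> (\<sigma> j)) = 0"
      using ind by (intro independentD[of "range \<sigma>" "range \<sigma>" "\<lambda>v. r (inv \<sigma> v)"])
        (auto simp: independent_family_def)
    then show ?thesis using ind by (simp add: independent_family_def)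
  qed
  have "x = 0" if x: "?M *v x = 0" for x
  proof -
    have s: "(\<Sum>j\<in>UNIV. trace (H i ** \<sigma> j) * x $ j) = 0" for i
      using x by (auto simp: vec_eq_iff matrix_vector_mult_def overlap_matrix_def)
    have im: "Im (trace (H i ** \<sigma> j)) = 0" for i j
      using cnj_trace_hermitian[OF hH hs] 
      by (simp add: complex_eq_iff)
    have re0: "(\<Sum>j\<in>UNIV. Re (x $ j) *\<^sub>R trace (H i ** \<sigma> j)) = 0" for i
      using arg_cong[OF s[of i], of Re] by (simp add: complex_eq_iff im mult.commute)
    have im0: "(\<Sum>j\<in>UNIV. Im (x $ j) *\<^sub>R trace (H i ** \<sigma> j)) = 0" for i
      using arg_cong[OF s[of i], of Im] by (simp add: complex_eq_iff im mult.commute)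
    have "Re (x $ j) = 0" "Im (x $ j) = 0" for j
      by (rule real_ker[OF re0], rule real_ker[OF im0])
    then show ?thesis by (simp add: vec_eq_iff complex_eq_iff)
  qed
  then show ?thesis by (simp add: invertible_left_inverse matrix_left_invertible_ker)
qed

lemma process_matrix_inverse:
  fixes H \<sigma> :: "'m::finite \<Rightarrow> complex^'n^'n"
  assumes "reference_process H \<sigma>"
  shows "overlap_matrix H \<sigma> ** process_matrix H \<sigma> = mat 1"
    and "process_matrix H \<sigma> ** overlap_matrix H \<sigma> = mat 1"
  using someI_ex[OF overlap_matrix_invertible[OF assms, unfolded invertible_def]]
  by (simp_all add: process_matrix_def matrix_inv_def)

lemma process_matrix_column_quasistochastic:
  fixes H \<sigma> :: "'m::finite \<Rightarrow> complex^'n^'n"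
  assumes "reference_process H \<sigma>"
  shows "column_quasistochastic (process_matrix H \<sigma>)"
proof -
  let ?M = "overlap_matrix H \<sigma>" and ?P = "process_matrix H \<sigma>"
  have mic: "mic H" and dens: "\<And>j. density_operator (\<sigma> j)"
    using assms by (auto simp: reference_process_def)
  have hH: "\<And>i. hermitian (H i)"
    using mic by (auto simp: mic_def positive_semidefinite_def)
  have Mreal: "cnj (?M $ i $ j) = ?M $ i $ j" for i j
    by (simp add: overlap_matrix_def cnj_trace_hermitian hH hermitian_density dens)
  have M1: "(\<Sum>i\<in>UNIV. ?M $ i $ j) = 1" for j
  proof -
    have "(\<Sum>i\<in>UNIV. ?M $ i $ j) = (\<Sum>i\<in>UNIV. trace (\<sigma> j ** (1 *\<^sub>R H i)))"
      by (simp add: overlap_matrix_def trace_mul_sym[of "\<sigma> j"])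
    also have "\<dots> = trace (\<sigma> j ** (\<Sum>i\<in>UNIV. 1 *\<^sub>R H i))"
      by (subst trace_mult_sum_scaleR) simp
    also have "\<dots> = 1" using mic dens by (simp add: mic_def density_operator_def)
    finally show ?thesis .
  qed
  have MP: "(\<Sum>k\<in>UNIV. ?M $ i $ k * ?P $ k $ j) = (if i = j then 1 else 0)" for i j
    using process_matrix_inverse(1)[OF assms]
    by (simp add: vec_eq_iff matrix_matrix_mult_def mat_def)
  define Q where "Q = (\<chi> i j. cnj (?P $ i $ j))"
  have "(\<Sum>k\<in>UNIV. ?M $ i $ k * cnj (?P $ k $ j)) = (if i = j then 1 else 0)" for i j
    using arg_cong[OF MP[of i j], of cnj] by (simp add: Mreal)
  then have "?M ** Q = mat 1"
    by (simp add: vec_eq_iff matrix_matrix_mult_def mat_def Q_def)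
  then have "Q = ?P"
    by (metis process_matrix_inverse(2)[OF assms] matrix_mul_assoc matrix_mul_lid matrix_mul_rid)
  then have "cnj (?P $ i $ j) = ?P $ i $ j" for i j
    by (simp add: Q_def vec_eq_iff)
  moreover have "(\<Sum>i\<in>UNIV. ?P $ i $ j) = 1" for j
  proof -
    have "(\<Sum>k\<in>UNIV. ?P $ k $ j) = (\<Sum>k\<in>UNIV. \<Sum>i\<in>UNIV. ?M $ i $ k * ?P $ k $ j)"
      by (simp add: M1 flip: sum_distrib_right)
    also have "\<dots> = (\<Sum>i\<in>UNIV. \<Sum>k\<in>UNIV. ?M $ i $ k * ?P $ k $ j)"
      by (rule sum.swap)
    also have "\<dots> = 1" by (simp add: MP)
    finally show ?thesis .
  qed
  ultimately show ?thesis by (simp add: column_quasistochastic_def Reals_cnj_iff)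
qed

definition matrix_norm :: "(complex^'m^'m \<Rightarrow> real) \<Rightarrow> bool" where
  "matrix_norm N \<longleftrightarrow>
     (\<forall>A. 0 \<le> N A) \<and>
     (\<forall>A. N A = 0 \<longleftrightarrow> A = 0) \<and>
     (\<forall>c A. N (\<chi> i j. c * A $ i $ j) = cmod c * N A) \<and>
     (\<forall>A B. N (A + B) \<le> N A + N B)"

definition unitarily_invariant_norm :: "(complex^'m^'m \<Rightarrow> real) \<Rightarrow> bool" where
  "unitarily_invariant_norm N \<longleftrightarrow>
     matrix_norm N \<and>
     (\<forall>A U V. unitary U \<longrightarrow> unitary V \<longrightarrow> N (U ** A ** V) = N A)"

end

theory Submission
  imports Defs
begin

text \<open>
  Let \<open>d\<close> be the dimension and \<open>A = I - \<Phi>\<close>. The columns of \<open>A\<close> sum to zero, so averaging \<open>A X\<close>, for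
  any orthogonal \<open>X\<close>, over all permutations gives a multiple of the centering projection \<open>C\<close>; since
  \<open>I - \<Phi>_SIC = -d C\<close>, it suffices to find \<open>X\<close> with \<open>trace ((\<Phi> - I) X) \<ge> d (d\<^sup>2 - 1)\<close>.
  A QR decomposition makes \<open>\<Phi> X\<close> triangular in an orthonormal basis, the diagonal consisting of \<open>1\<close> and of numbers
  \<open>s i \<ge> 0\<close> with product \<open>\<bar>det \<Phi>\<bar>\<close>. The inverse of \<open>\<Phi>\<close> has the determinant of the
  measure-and-prepare map of the process, a trace-preserving map of nuclear norm at most \<open>d\<close>; the same
  decomposition gives \<open>1\<close> and numbers \<open>r i \<ge> 0\<close> with sum at most \<open>d - 1\<close>, and the product of all
  \<open>r i * s i\<close> is \<open>1\<close>. The inequality between arithmetic and geometric means then bounds the sum of the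
  \<open>s i\<close>. In the case of equality \<open>X = I\<close> and all \<open>s i = d + 1\<close>, which determines \<open>\<Phi>\<close> up to a vector,
  and the Cauchy-Schwarz inequality for \<open>trace (H i ** \<sigma> i)\<close> does the rest.
\<close>

subsection \<open>Triangular forms of real matrices\<close>

text \<open>The enumeration is the order used for Gram-Schmidt and for triangularity. The
  distinguished index comes first because its basis vector is the one that is fixed.\<close>

lemma enumeration_from:
  fixes k :: "'m::finite"
  obtains f :: "'m \<Rightarrow> nat" where "bij_betw f UNIV {..<CARD('m)}" "f k = 0"
proof -
  obtain h :: "'m \<Rightarrow> nat" where h: "bij_betw h UNIV {..<CARD('m)}"
    using ex_bij_betw_finite_nat[of "UNIV :: 'm set"] by (auto simp: atLeast0LessThan)
  have perm: "Transposition.transpose 0 (h k) permutes {..<CARD('m)}"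
    using h by (intro permutes_swap_id) (auto simp: bij_betw_def)
  have "bij_betw (Transposition.transpose 0 (h k) \<circ> h) UNIV {..<CARD('m)}"
    by (rule bij_betw_trans[OF h permutes_imp_bij[OF perm]])
  then show thesis by (rule that) simp
qed

text \<open>Gram-Schmidt without linear independence of the \<open>x i\<close>. The span condition
  is carried through the induction so that a new \<open>q i\<close>, orthogonal to the earlier
  \<open>q j\<close>, is also orthogonal to the earlier \<open>x j\<close>.\<close>

lemma gram_schmidt_nonneg:
  fixes x :: "nat \<Rightarrow> 'a::euclidean_space"
  assumes "k \<le> DIM('a)" "norm (x 0) = 1"
  shows "\<exists>q. q 0 = x 0 \<and> (\<forall>i<k. norm (q i) = 1 \<and> 0 \<le> q i \<bullet> x i \<and> x i \<in> span (q ` {..i}) \<and>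
    (\<forall>j<i. q i \<bullet> q j = 0 \<and> q i \<bullet> x j = 0))"
  using assms(1)
proof (induction k)
  case 0
  then show ?case by auto
next
  case (Suc k)
  then obtain q where q0: "q 0 = x 0"
    and q: "\<And>i. i < k \<Longrightarrow> norm (q i) = 1 \<and> 0 \<le> q i \<bullet> x i \<and> x i \<in> span (q ` {..i}) \<and>
      (\<forall>j<i. q i \<bullet> q j = 0 \<and> q i \<bullet> x j = 0)"
    by auto
  show ?case
  proof (cases "k = 0")
    case True
    with assms(2) q0 show ?thesis
      by (intro exI[of _ q]) (auto simp: span_base)
  next
    case False
    let ?S = "q ` {..<k}"
    obtain y z where y: "y \<in> span ?S" and z: "\<And>w. w \<in> span ?S \<Longrightarrow> orthogonal z w"
      and xk: "x k = y + z"
      using orthogonal_subspace_decomp_exists[of ?S "x k"] by metis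
    have "dim ?S \<le> card ?S" by (rule dim_le_card') simp
    also have "\<dots> \<le> k" using card_image_le[of "{..<k}" q] by simp
    finally have "dim ?S < DIM('a)" using Suc.prems by simp
    then obtain e0 where e0: "e0 \<noteq> 0" "\<And>w. w \<in> span ?S \<Longrightarrow> orthogonal e0 w"
      using orthogonal_to_subspace_exists by blast
    \<comment> \<open>If the residual \<open>z\<close> vanishes, any unit vector orthogonal to the
      earlier ones serves, and its product with \<open>x k\<close> is zero. It exists because fewer
      than \<open>DIM('a)\<close> vectors have been chosen.\<close>
    define e where "e = (if z = 0 then sgn e0 else sgn z)"
    have e1: "norm e = 1" using e0 by (simp add: e_def norm_sgn)
    have eo: "e \<bullet> w = 0" if "w \<in> span ?S" for w
      using e0(2)[OF that] z[OF that] by (simp add: e_def orthogonal_def sgn_div_norm)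
    have ez: "z = norm z *\<^sub>R e" by (simp add: e_def sgn_div_norm)
    have "e \<bullet> x k = norm z * (e \<bullet> e)"
      using eo[OF y] ez by (metis xk inner_add_right inner_scaleR_right add_0)
    then have pos: "0 \<le> e \<bullet> x k" by simp
    define q' where "q' = q(k := e)"
    have q'k: "q' ` {..k} = insert e ?S"
      by (auto simp: q'_def)
    have xs: "x k \<in> span (q' ` {..k})"
      unfolding q'k xk
      by (subst ez) (intro span_add span_mul span_base insertI1 subsetD[OF span_mono y]; auto)
    have im: "q' ` {..i} = q ` {..i}" if "i < k" for i
      using that by (auto simp: q'_def)
    have "x j \<in> span ?S" if "j < k" for j
      using q[OF that] span_mono[of "q ` {..j}" ?S] that by (force simp: image_mono)
    then have eoj: "e \<bullet> q j = 0 \<and> e \<bullet> x j = 0" if "j < k" for j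
      using that eo by (simp add: span_base)
    show ?thesis
    proof (intro exI[of _ q'] conjI allI impI)
      show "q' 0 = x 0" using False q0 by (simp add: q'_def)
    next
      fix i assume "i < Suc k"
      then consider "i < k" | "i = k" by linarith
      then show "norm (q' i) = 1" "0 \<le> q' i \<bullet> x i" "x i \<in> span (q' ` {..i})"
        using q[of i] im[of i] e1 pos xs by (cases; auto simp: q'_def)+
    next
      fix i j assume "i < Suc k" "j < i"
      then consider "i < k" "j < k" | "i = k" "j < k" by linarith
      then show "q' i \<bullet> q' j = 0" "q' i \<bullet> x j = 0"
        using q[of i] eoj[of j] \<open>j < i\<close> by (cases; auto simp: q'_def)+
    qed
  qed
qed

text \<open>A permutation that never lowers \<open>f\<close> preserves the sum of \<open>f\<close>,
  so it preserves \<open>f\<close> pointwise and is the identity. Every other term of the Leibniz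
  formula therefore contains a zero entry.\<close>

lemma det_triangular:
  fixes R :: "'a::comm_ring_1^'m::finite^'m" and f :: "'m \<Rightarrow> nat"
  assumes "inj f" and tri: "\<And>i j. f j < f i \<Longrightarrow> R $ i $ j = 0"
  shows "det R = (\<Prod>i\<in>UNIV. R $ i $ i)"
proof -
  have zero: "of_int (sign p) * (\<Prod>i\<in>UNIV. R $ i $ p i) = 0"
    if p: "p permutes UNIV" and "p \<noteq> id" for p
  proof -
    have "\<exists>i. f (p i) < f i"
    proof (rule ccontr)
      assume "\<not> ?thesis"
      then have le: "f i \<le> f (p i)" for i by (simp add: not_less)
      have eq: "(\<Sum>i\<in>UNIV. f (p i)) = (\<Sum>i\<in>UNIV. f i)"
        using sum.permute[OF p, of f] by (simp add: o_def)
      have "f (p i) = f i" for i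
      proof (rule ccontr)
        assume "f (p i) \<noteq> f i"
        then have "(\<Sum>i\<in>UNIV. f i) < (\<Sum>i\<in>UNIV. f (p i))"
          using le by (intro sum_strict_mono_ex1) (auto simp: neq_iff not_less intro!: exI[of _ i] le_neq_implies_less)
        with eq show False by simp
      qed
      with \<open>inj f\<close> \<open>p \<noteq> id\<close> show False by (auto simp: inj_def)
    qed
    then obtain i where "R $ i $ p i = 0" using tri by auto
    then have "(\<Prod>i\<in>UNIV. R $ i $ p i) = 0" by (intro prod_zero) auto
    then show ?thesis by simp
  qed
  have "det R = (\<Sum>p\<in>{id}. of_int (sign p) * (\<Prod>i\<in>UNIV. R $ i $ p i))"
    unfolding det_def
    by (rule sum.mono_neutral_right) (auto simp: permutes_id zero)
  then show ?thesis by (simp add: sign_id)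
qed

text \<open>Gram-Schmidt runs over the columns of \<open>Z\<close> in the order of \<open>f\<close>.
  Column \<open>k\<close> comes first and is already a unit vector, so it is kept unchanged, which
  gives the diagonal entry 1.\<close>

lemma qr_decomposition_nonneg:
  fixes Z :: "real^'m^'m" and f :: "'m \<Rightarrow> nat"
  assumes bij: "bij_betw f UNIV {..<CARD('m)}" and f0: "f k = 0"
    and col: "norm (column k Z) = 1"
  shows "\<exists>Q. orthogonal_matrix Q \<and> (\<forall>i j. f j < f i \<longrightarrow> (transpose Q ** Z) $ i $ j = 0) \<and>
    (\<forall>i. 0 \<le> (transpose Q ** Z) $ i $ i) \<and> (transpose Q ** Z) $ k $ k = 1"
proof -
  have inj: "inj f" and fl: "f i < CARD('m)" for i
    using bij by (auto simp: bij_betw_def)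
  have g: "inv f (f i) = i" for i using inj by simp
  define x where "x n = column (inv f n) Z" for n
  have x: "x (f i) = column i Z" for i by (simp add: x_def g)
  have "norm (x 0) = 1" using x[of k] f0 col by simp
  then obtain q where q0: "q 0 = x 0"
    and q: "\<And>i. i < CARD('m) \<Longrightarrow> norm (q i) = 1 \<and> 0 \<le> q i \<bullet> x i \<and>
      (\<forall>j<i. q i \<bullet> q j = 0 \<and> q i \<bullet> x j = 0)"
    using gram_schmidt_nonneg[of "CARD('m)" x] by auto
  define Q :: "real^'m^'m" where "Q = (\<chi> i j. q (f j) $ i)"
  have colQ: "column j Q = q (f j)" for j by (simp add: Q_def column_def vec_eq_iff)
  have R: "(transpose Q ** Z) $ i $ j = q (f i) \<bullet> x (f j)" for i j
    by (simp add: matrix_matrix_mult_def transpose_def Q_def x inner_vec_def column_def)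
  have "q (f i) \<bullet> q (f j) = 0" if "i \<noteq> j" for i j
  proof -
    have "f i \<noteq> f j" using inj that by (simp add: inj_eq)
    then show ?thesis
      using q[OF fl[of i]] q[OF fl[of j]] by (metis inner_commute nat_neq_iff)
  qed
  then have "orthogonal_matrix Q"
    using q[OF fl] by (simp add: orthogonal_matrix_orthonormal_columns colQ orthogonal_def)
  moreover have "q (f k) \<bullet> x (f k) = 1"
    using q0 f0 \<open>norm (x 0) = 1\<close> by (simp add: norm_eq_1)
  ultimately show ?thesis
    using q[OF fl] by (intro exI[of _ Q]) (auto simp: R)
qed

lemma orthogonal_matrixD:
  fixes W :: "real^'m^'m"
  assumes "orthogonal_matrix W"
  shows "transpose W ** W = mat 1" "W ** transpose W = mat 1"
  using assms by (auto simp: orthogonal_matrix_def)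

lemma abs_det_orthogonal_matrix:
  fixes W :: "real^'m^'m"
  assumes "orthogonal_matrix W"
  shows "\<bar>det W\<bar> = 1"
  using det_orthogonal_matrix[OF assms] by auto

text \<open>Conjugation by \<open>W\<close> moves the fixed vector \<open>u\<close> to a coordinate
  axis, where the QR decomposition applies; its orthogonal factor carried back is \<open>X\<close>.
  Trace and absolute determinant are then read off one and the same diagonal.\<close>

lemma triangular_form_fixing_vector:
  fixes Y W :: "real^'m^'m" and f :: "'m \<Rightarrow> nat"
  assumes bij: "bij_betw f UNIV {..<CARD('m)}" and f0: "f k = 0"
    and W: "orthogonal_matrix W" and u: "W *v axis k 1 = u" and Y: "Y *v u = u"
  obtains X R where "orthogonal_matrix X" "transpose X ** Y = W ** R ** transpose W"
    "\<And>i j. f j < f i \<Longrightarrow> R $ i $ j = 0" "\<And>i. 0 \<le> R $ i $ i" "R $ k $ k = 1"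
    "trace (transpose X ** Y) = (\<Sum>i\<in>UNIV. R $ i $ i)" "\<bar>det Y\<bar> = (\<Prod>i\<in>UNIV. R $ i $ i)"
proof -
  note WW = orthogonal_matrixD[OF W]
  define Z where "Z = transpose W ** Y ** W"
  have "Z *v axis k 1 = transpose W *v u"
    using u Y by (simp add: Z_def flip: matrix_vector_mul_assoc)
  also have "\<dots> = axis k 1"
    using WW(1) by (simp add: matrix_vector_mul_assoc flip: u)
  finally have "column k Z = axis k 1"
    by (simp add: matrix_vector_mult_basis)
  then have "norm (column k Z) = 1" by simp
  from qr_decomposition_nonneg[OF bij f0 this] obtain Q where Q: "orthogonal_matrix Q"
    and R: "\<And>i j. f j < f i \<Longrightarrow> (transpose Q ** Z) $ i $ j = 0"
      "\<And>i. 0 \<le> (transpose Q ** Z) $ i $ i" "(transpose Q ** Z) $ k $ k = 1"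
    by blast
  let ?R = "transpose Q ** Z"
  define X where "X = W ** Q ** transpose W"
  have X: "orthogonal_matrix X"
    unfolding X_def by (intro orthogonal_matrix_mul) (auto simp: W Q)
  have XY: "transpose X ** Y = W ** ?R ** transpose W"
    using WW by (simp add: X_def Z_def matrix_transpose_mul flip: matrix_mul_assoc)
  have tr: "trace (transpose X ** Y) = trace ?R"
    unfolding XY by (subst trace_mul_sym) (simp add: matrix_mul_assoc WW)
  have "det ?R = (\<Prod>i\<in>UNIV. ?R $ i $ i)"
    using bij R(1) by (intro det_triangular[of f]) (auto simp: bij_betw_def)
  moreover have "\<bar>det ?R\<bar> = \<bar>det Y\<bar>"
    by (simp add: Z_def det_mul abs_mult abs_det_orthogonal_matrix W Q)
  ultimately have "\<bar>det Y\<bar> = (\<Prod>i\<in>UNIV. ?R $ i $ i)"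
    using R(2) by (simp add: prod_nonneg)
  with that[OF X XY R] tr show ?thesis by (simp add: trace_def)
qed

section \<open>Traces of orthogonal matrices\<close>

lemma orthogonal_matrix_entry_le_1:
  fixes X :: "real^'m^'m"
  assumes "orthogonal_matrix X"
  shows "X $ i $ j \<le> 1"
proof -
  have "norm (column j X) = 1"
    using assms by (simp add: orthogonal_matrix_orthonormal_columns)
  then show ?thesis
    using component_le_norm_cart[of "column j X" i] by (simp add: column_def)
qed

lemma orthogonal_matrix_trace_le:
  fixes X :: "real^'m^'m"
  assumes "orthogonal_matrix X"
  shows "trace X \<le> CARD('m)"
  unfolding trace_def
  using sum_bounded_above[of UNIV "\<lambda>i. X $ i $ i" 1] orthogonal_matrix_entry_le_1[OF assms] by simp

text \<open>The trace is maximal only if every diagonal entry is 1, and a unit column with an entry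
  1 is a coordinate vector. In the equality case this removes the auxiliary orthogonal
  factor.\<close>

lemma orthogonal_matrix_trace_eq:
  fixes X :: "real^'m^'m"
  assumes "orthogonal_matrix X" "trace X \<ge> CARD('m)"
  shows "X = mat 1"
proof -
  have "(\<Sum>i\<in>UNIV. 1 - X $ i $ i) = 0"
    using orthogonal_matrix_trace_le[OF assms(1)] assms(2) by (simp add: sum_subtractf trace_def)
  then have diag: "X $ i $ i = 1" for i
    using orthogonal_matrix_entry_le_1[OF assms(1)] by (simp add: sum_nonneg_eq_0_iff)
  have "column i X = axis i 1" for i
  proof -
    have n: "column i X \<bullet> column i X = 1"
      using assms(1) by (simp add: orthogonal_matrix_orthonormal_columns norm_eq_1)
    have "column i X \<bullet> axis i 1 = 1"
      using diag[of i] by (simp add: inner_axis column_def)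
    with n have "(column i X - axis i 1) \<bullet> (column i X - axis i 1) = 0"
      by (simp add: inner_diff_left inner_diff_right inner_commute inner_axis_axis)
    then show ?thesis by simp
  qed
  then show ?thesis by (auto simp: vec_eq_iff column_def axis_def mat_def)
qed

subsection \<open>Unitarily invariant norms\<close>

text \<open>The orthogonal projection onto the vectors whose coordinates sum to zero.\<close>

definition centering :: "complex^'m^'m" where
  "centering = (\<chi> i j. (if i = j then 1 else 0) - 1 / of_nat CARD('m))"

lemma norm_permute:
  fixes A :: "complex^'m^'m"
  assumes "unitarily_invariant_norm N" and p: "p permutes UNIV"
  shows "N (\<chi> i j. A $ p i $ p j) = N A"
proof -
  define U :: "complex^'m^'m" where "U = (\<chi> i j. if j = p i then 1 else 0)"
  define V :: "complex^'m^'m" where "V = (\<chi> i j. if i = p j then 1 else 0)"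
  have inj: "p i = p j \<longleftrightarrow> i = j" for i j
    using permutes_inj[OF p] by (simp add: inj_eq)
  have "U ** V = mat 1"
    by (simp add: U_def V_def matrix_matrix_mult_def mat_def vec_eq_iff inj if_distrib[of "\<lambda>x. x * _"] cong: if_cong)
  then have "V ** U = mat 1" by (simp add: matrix_left_right_inverse)
  moreover have "conj_transpose U = V" "conj_transpose V = U"
    by (auto simp: conj_transpose_def U_def V_def vec_eq_iff)
  ultimately have "unitary U" "unitary V"
    using \<open>U ** V = mat 1\<close> by (simp_all add: unitary_def)
  moreover have "(\<chi> i j. A $ p i $ p j) = U ** A ** V"
    by (simp add: U_def V_def matrix_matrix_mult_def vec_eq_iff if_distrib[of "\<lambda>x. x * _"]
        if_distrib[of "\<lambda>x. _ * x"] cong: if_cong)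
  ultimately show ?thesis
    using assms(1) by (simp add: unitarily_invariant_norm_def)
qed

lemma matrix_norm_zero: "matrix_norm N \<Longrightarrow> N 0 = 0"
  unfolding matrix_norm_def by blast

lemma matrix_norm_sum:
  assumes "matrix_norm N"
  shows "N (\<Sum>x\<in>F. A x) \<le> (\<Sum>x\<in>F. N (A x))"
proof (induction F rule: infinite_finite_induct)
  case (infinite F)
  then show ?case using matrix_norm_zero[OF assms] by simp
next
  case empty
  then show ?case using matrix_norm_zero[OF assms] by simp
next
  case (insert x F)
  have "N (A x + sum A F) \<le> N (A x) + N (sum A F)"
    using assms by (simp add: matrix_norm_def)
  with insert show ?case by simp
qed

text \<open>
  Averaging over simultaneous permutations of rows and columns maps \<open>A\<close> to a combination of the
  identity and the all-ones matrix; vanishing column sums make it a multiple of \<open>centering\<close>.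
\<close>

lemma trace_norm_centering_le:
  fixes A :: "complex^'m^'m"
  assumes N: "unitarily_invariant_norm N" and col: "\<And>j. (\<Sum>i\<in>UNIV. A $ i $ j) = 0"
  shows "cmod (trace A) * N centering \<le> (real CARD('m) - 1) * N A"
proof -
  let ?P = "{p. p permutes (UNIV::'m set)}"
  let ?m = "of_nat CARD('m) :: complex"
  \<comment> \<open>The average is left unnormalised. Its invariance under simultaneous permutations
    of both indices makes it constant on the diagonal and constant off it.\<close>
  define S where "S i j = (\<Sum>p\<in>?P. A $ p i $ p j)" for i j
  have mn: "matrix_norm N" using N by (simp add: unitarily_invariant_norm_def)
  have scale: "N (\<chi> i j. c * B $ i $ j) = cmod c * N B" for c B
    using mn by (simp add: matrix_norm_def)
  have inv: "S (q i) (q j) = S i j" if "q permutes UNIV" for q i j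
    unfolding S_def using sum_permutations_compose_right[OF that, of "\<lambda>p. A $ p i $ p j"]
    by (simp add: o_def)
  have sw: "Transposition.transpose a b permutes UNIV" for a b :: 'm
    by (rule permutes_swap_id) auto
  have diag: "S i i = S j j" for i j
    using inv[OF sw[of i j], of i i] by simp
  have trS: "(\<Sum>i\<in>UNIV. S i i) = fact CARD('m) * trace A"
  proof -
    have "(\<Sum>i\<in>UNIV. S i i) = (\<Sum>p\<in>?P. \<Sum>i\<in>UNIV. A $ p i $ p i)"
      unfolding S_def by (rule sum.swap)
    also have "\<dots> = (\<Sum>p\<in>?P. trace A)"
    proof (rule sum.cong)
      fix p assume "p \<in> ?P"
      then show "(\<Sum>i\<in>UNIV. A $ p i $ p i) = trace A"
        using sum.permute[of p UNIV "\<lambda>i. A $ i $ i"] by (simp add: trace_def o_def)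
    qed simp
    also have "\<dots> = fact CARD('m) * trace A"
      by (simp add: card_permutations[of UNIV "CARD('m)"])
    finally show ?thesis .
  qed
  have mS: "?m * S j j = fact CARD('m) * trace A" for j
    using trS sum.cong[of UNIV UNIV "\<lambda>i. S i i" "\<lambda>i. S j j"] diag[of _ j] by simp
  have colS: "(\<Sum>i\<in>UNIV. S i j) = 0" for j
  proof -
    have "(\<Sum>i\<in>UNIV. S i j) = (\<Sum>p\<in>?P. \<Sum>i\<in>UNIV. A $ p i $ p j)"
      unfolding S_def by (rule sum.swap)
    also have "\<dots> = (\<Sum>p\<in>?P. 0)"
    proof (rule sum.cong)
      fix p assume "p \<in> ?P"
      then show "(\<Sum>i\<in>UNIV. A $ p i $ p j) = 0"
        using sum.permute[of p UNIV "\<lambda>i. A $ i $ p j"] by (simp add: o_def col)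
    qed simp
    finally show ?thesis by simp
  qed
  \<comment> \<open>The \<open>m - 1\<close> equal off-diagonal entries of column \<open>j\<close>
    cancel the diagonal one. The factor is kept rather than divided by, so that the one-element
    index type needs no separate treatment.\<close>
  have off: "(?m - 1) * S i j = - S j j" if "i \<noteq> j" for i j
  proof -
    have "S k j = S i j" if "k \<noteq> j" for k
      using inv[OF sw[of i k], of i j] \<open>i \<noteq> j\<close> that by (simp add: transpose_apply_other)
    then have "(\<Sum>k\<in>UNIV - {j}. S k j) = (\<Sum>k\<in>UNIV - {j}. S i j)"
      by (intro sum.cong) auto
    then have "(\<Sum>k\<in>UNIV. S k j) = S j j + (?m - 1) * S i j"
      by (simp add: sum.remove[of UNIV j] card_Diff_singleton of_nat_diff)
    with colS[of j] show ?thesis by (simp add: eq_neg_iff_add_eq_0 add.commute)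
  qed
  have S_eq: "(?m - 1) * S i j = fact CARD('m) * trace A * centering $ i $ j" for i j
  proof (cases "i = j")
    case True
    then show ?thesis using mS[of j] by (simp add: centering_def field_simps)
  next
    case False
    have "?m * ((?m - 1) * S i j) = - (?m * S j j)"
      unfolding off[OF False] by simp
    then have "?m * ((?m - 1) * S i j) = - (fact CARD('m) * trace A)"
      unfolding mS .
    then show ?thesis using False by (simp add: centering_def field_simps)
  qed
  have "fact CARD('m) * cmod (trace A) * N centering =
      N (\<chi> i j. fact CARD('m) * trace A * centering $ i $ j)"
    by (simp only: scale) (simp add: norm_mult)
  also have "\<dots> = N (\<chi> i j. (?m - 1) * (\<Sum>p\<in>?P. \<chi> i j. A $ p i $ p j) $ i $ j)"
    by (simp add: S_def flip: S_eq)
  also have "\<dots> = (real CARD('m) - 1) * N (\<Sum>p\<in>?P. \<chi> i j. A $ p i $ p j)"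
  proof -
    have "cmod (?m - 1) = real CARD('m) - 1"
      using norm_of_nat[of "CARD('m) - 1", where 'a = complex] by (simp add: of_nat_diff)
    then show ?thesis by (simp only: scale)
  qed
  also have "\<dots> \<le> (real CARD('m) - 1) * (\<Sum>p\<in>?P. N (\<chi> i j. A $ p i $ p j))"
    by (intro mult_left_mono matrix_norm_sum mn) simp
  also have "\<dots> = fact CARD('m) * ((real CARD('m) - 1) * N A)"
    by (simp add: norm_permute[OF N] card_permutations[of UNIV "CARD('m)"])
  finally show ?thesis by (simp add: mult.assoc)
qed

lemma unitarily_invariant_norm_mult_orthogonal:
  fixes A :: "complex^'m^'m" and X :: "real^'m^'m"
  assumes "unitarily_invariant_norm N" "orthogonal_matrix X"
  shows "N (A ** (\<chi> i j. of_real (X $ i $ j))) = N A"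
proof -
  let ?U = "\<chi> i j. complex_of_real (X $ i $ j)"
  have "(\<Sum>k\<in>UNIV. X $ k $ i * X $ k $ j) = (if i = j then 1 else 0)"
    "(\<Sum>k\<in>UNIV. X $ i $ k * X $ j $ k) = (if i = j then 1 else 0)" for i j
    using assms(2) by (auto simp: orthogonal_matrix_def vec_eq_iff matrix_matrix_mult_def
        transpose_def mat_def)
  from this[THEN arg_cong[of _ _ complex_of_real]] have "unitary ?U"
    by (simp add: unitary_def conj_transpose_def matrix_matrix_mult_def mat_def vec_eq_iff)
  moreover have "unitary (mat 1 :: complex^'m^'m)"
    by (simp add: unitary_def conj_transpose_def mat_def vec_eq_iff matrix_matrix_mult_def
        if_distrib[of "\<lambda>x. x * _"] if_distrib[of cnj] cong: if_cong)
  ultimately have "N (mat 1 ** A ** ?U) = N A"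
    using assms(1) unfolding unitarily_invariant_norm_def by blast
  then show ?thesis by simp
qed

subsection \<open>Positive semidefinite matrices\<close>

definition sesqui :: "complex^'n^'n \<Rightarrow> complex^'n \<Rightarrow> complex^'n \<Rightarrow> complex" where
  "sesqui A x y = (\<Sum>i\<in>UNIV. cnj (x $ i) * (A *v y) $ i)"

lemma sesqui_diff_scale:
  "sesqui A (a *s x - b *s y) (a *s x - b *s y) =
    cnj a * a * sesqui A x x - cnj a * b * sesqui A x y - cnj b * a * sesqui A y x
      + cnj b * b * sesqui A y y"
  by (simp add: sesqui_def matrix_vector_mult_diff_distrib vector_scalar_commute
      sum_distrib_left flip: sum.distrib sum_subtractf) (simp add: algebra_simps)

lemma sesqui_hermitian:
  assumes "hermitian A"
  shows "sesqui A y x = cnj (sesqui A x y)"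
proof -
  have "sesqui A y x = (\<Sum>i\<in>UNIV. \<Sum>j\<in>UNIV. cnj (y $ i) * (A $ i $ j * x $ j))"
    by (simp add: sesqui_def matrix_vector_mult_def sum_distrib_left)
  also have "\<dots> = (\<Sum>j\<in>UNIV. \<Sum>i\<in>UNIV. cnj (y $ i) * (A $ i $ j * x $ j))"
    by (rule sum.swap)
  also have "\<dots> = cnj (sesqui A x y)"
    by (simp add: sesqui_def matrix_vector_mult_def sum_distrib_left hermitian_cnj[OF assms] ac_simps)
  finally show ?thesis .
qed

lemma matrix_vector_mult_axis: "(A *v axis j 1) $ i = (A $ i $ j :: 'a::semiring_1)"
  by (simp add: matrix_vector_mult_def axis_def if_distrib[of "\<lambda>x. _ * x"] cong: if_cong)

lemma sesqui_axis: "sesqui A (axis i 1) (axis j 1) = A $ i $ j"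
  unfolding sesqui_def matrix_vector_mult_axis
  by (simp add: axis_def if_distrib[of cnj] if_distrib[of "\<lambda>x. x * _"] cong: if_cong)

lemma sesqui_axis_left: "sesqui A (axis i 1) y = (A *v y) $ i"
  by (simp add: sesqui_def axis_def if_distrib[of cnj] if_distrib[of "\<lambda>x. x * _"] cong: if_cong)

text \<open>The form is nonnegative at \<open>a x - t cnj b y\<close> with
  \<open>b = sesqui A x y\<close> and real \<open>a\<close>, \<open>t\<close>. If the form at
  \<open>y\<close> is positive, it is taken as \<open>a\<close>, with \<open>t = 1\<close>; if it
  vanishes, a large \<open>t\<close> forces \<open>b = 0\<close>.\<close>

lemma psd_cauchy_schwarz:
  assumes "positive_semidefinite A"
  shows "(cmod (sesqui A x y))\<^sup>2 \<le> Re (sesqui A x x) * Re (sesqui A y y)"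
proof -
  have h: "hermitian A" and nn: "0 \<le> Re (sesqui A v v)" for v
    using assms by (auto simp: positive_semidefinite_def sesqui_def)
  have im: "sesqui A v v = of_real (Re (sesqui A v v))" for v
    using sesqui_hermitian[OF h, of v v] by (simp add: complex_eq_iff)
  have key: "0 \<le> a\<^sup>2 * Re (sesqui A x x) - 2 * a * t * (cmod (sesqui A x y))\<^sup>2
      + t\<^sup>2 * (cmod (sesqui A x y))\<^sup>2 * Re (sesqui A y y)" for a t :: real and x y
  proof -
    let ?b = "sesqui A x y"
    have b: "cnj ?b * ?b = of_real ((cmod ?b)\<^sup>2)"
      by (simp only: complex_norm_square mult.commute)
    have "sesqui A (of_real a *s x - (of_real t * cnj ?b) *s y)
        (of_real a *s x - (of_real t * cnj ?b) *s y) =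
      of_real (a\<^sup>2) * sesqui A x x - 2 * of_real (a * t) * (cnj ?b * ?b)
        + of_real (t\<^sup>2) * (cnj ?b * ?b) * sesqui A y y"
      by (subst sesqui_diff_scale)
        (simp add: sesqui_hermitian[OF h, of y x] power2_eq_square algebra_simps)
    also have "\<dots> = of_real (a\<^sup>2 * Re (sesqui A x x) - 2 * a * t * (cmod ?b)\<^sup>2
        + t\<^sup>2 * (cmod ?b)\<^sup>2 * Re (sesqui A y y))"
      unfolding b by (subst (1 2) im) (simp add: algebra_simps)
    finally show ?thesis
      using nn[of "of_real a *s x - (of_real t * cnj ?b) *s y"] by simp
  qed
  let ?p = "Re (sesqui A x x)" and ?q = "Re (sesqui A y y)" and ?c = "(cmod (sesqui A x y))\<^sup>2"
  show ?thesis
  proof (cases "?q = 0")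
    case True
    have "0 \<le> ?p - 2 * t * ?c" for t using key[of 1 x t y] True by simp
    \<comment> \<open>If \<open>?c\<close> were nonzero, this \<open>t\<close> would turn the
      right-hand side into -1.\<close>
    from this[of "(?p + 1) / (2 * ?c)"] have "?c = 0"
      by (cases "?c = 0") (auto simp: field_simps)
    then show ?thesis using True by simp
  next
    case False
    then have "0 < ?q" using nn[of y] by simp
    have "0 \<le> ?q * (?p * ?q - ?c)"
      using key[of ?q x 1 y] by (simp add: power2_eq_square algebra_simps)
    with \<open>0 < ?q\<close> show ?thesis by (simp add: zero_le_mult_iff)
  qed
qed

lemma psd_entry_le:
  assumes "positive_semidefinite A"
  shows "(cmod (A $ i $ j))\<^sup>2 \<le> Re (A $ i $ i) * Re (A $ j $ j)"
  using psd_cauchy_schwarz[OF assms, of "axis i 1" "axis j 1"] by (simp add: sesqui_axis)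

lemma psd_diag_nonneg:
  assumes "positive_semidefinite A"
  shows "0 \<le> Re (A $ i $ i)"
proof -
  have "0 \<le> Re (sesqui A (axis i 1) (axis i 1))"
    using assms unfolding positive_semidefinite_def sesqui_def by blast
  then show ?thesis by (simp add: sesqui_axis)
qed

lemma norm_matrix_square:
  fixes A :: "complex^'n^'m"
  shows "(norm A)\<^sup>2 = (\<Sum>i\<in>UNIV. \<Sum>j\<in>UNIV. (cmod (A $ i $ j))\<^sup>2)"
  by (simp add: norm_vec_def L2_set_def sum_nonneg)

lemma Re_trace_square:
  fixes A :: "complex^'n^'n"
  shows "(Re (trace A))\<^sup>2 = (\<Sum>i\<in>UNIV. \<Sum>j\<in>UNIV. Re (A $ i $ i) * Re (A $ j $ j))"
  by (simp add: trace_def power2_eq_square sum_product)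

lemma psd_trace_nonneg: "positive_semidefinite A \<Longrightarrow> 0 \<le> Re (trace A)"
  by (simp add: trace_def sum_nonneg psd_diag_nonneg)

text \<open>The norm of the type is the Frobenius norm, so \<open>psd_entry_le\<close> compares the
  two squares term by term.\<close>

lemma psd_norm_le_trace:
  assumes "positive_semidefinite A"
  shows "norm A \<le> Re (trace A)"
proof -
  have "(norm A)\<^sup>2 \<le> (Re (trace A))\<^sup>2"
    unfolding norm_matrix_square Re_trace_square by (intro sum_mono psd_entry_le assms)
  then show ?thesis using psd_trace_nonneg[OF assms] by (rule power2_le_imp_le)
qed

text \<open>Equality holds in every term of the comparison behind \<open>psd_norm_le_trace\<close>,
  so all the 2 by 2 principal minors vanish. Each of them yields a kernel vector, and together these
  make all rows multiples of one row.\<close>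

lemma psd_rank_1:
  fixes A :: "complex^'n^'n"
  assumes A: "positive_semidefinite A" and "A \<noteq> 0" and eq: "norm A = Re (trace A)"
  shows "rank A = 1"
proof -
  have h: "hermitian A" using A by (simp add: positive_semidefinite_def)
  let ?e = "\<lambda>i j. Re (A $ i $ i) * Re (A $ j $ j) - (cmod (A $ i $ j))\<^sup>2"
  have z: "(\<Sum>i\<in>UNIV. \<Sum>j\<in>UNIV. ?e i j) = 0"
    using eq norm_matrix_square[of A] Re_trace_square[of A] by (simp add: sum_subtractf)
  have e: "?e i j = 0" for i j
    using z psd_entry_le[OF A] by (simp add: sum_nonneg_eq_0_iff sum_nonneg)
  obtain k where k: "Re (A $ k $ k) \<noteq> 0"
  proof (rule ccontr)
    assume "\<not> thesis"
    then have "Re (A $ k $ k) = 0" for k using that by blast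
    then have "A $ i $ j = 0" for i j using e[of i j] by simp
    with \<open>A \<noteq> 0\<close> show False by (simp add: vec_eq_iff)
  qed
  have real: "A $ i $ i = of_real (Re (A $ i $ i))" for i
    using hermitian_cnj[OF h, of i i] by (simp add: complex_eq_iff)
  have col: "A $ k $ k * A $ l $ j = A $ k $ j * A $ l $ k" for l j
  proof -
    \<comment> \<open>The quadratic form vanishes at this vector, so by Cauchy-Schwarz
      \<open>A\<close> annihilates it.\<close>
    let ?x = "(A $ k $ k) *s axis j 1 - (A $ k $ j) *s (axis k 1 :: complex^'n)"
    have sq: "A $ k $ j * A $ j $ k = of_real (Re (A $ k $ k) * Re (A $ j $ j))"
      using e[of k j] complex_norm_square[of "A $ k $ j"] by (simp add: hermitian_cnj[OF h])
    have "sesqui A ?x ?x = A $ k $ k * (A $ k $ k * A $ j $ j - A $ k $ j * A $ j $ k)"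
      by (subst sesqui_diff_scale) (simp add: sesqui_axis hermitian_cnj[OF h] algebra_simps)
    also have "A $ k $ k * A $ j $ j = A $ k $ j * A $ j $ k"
      unfolding sq of_real_mult by (rule arg_cong2[OF real real])
    finally have "sesqui A (axis l 1) ?x = 0"
      using psd_cauchy_schwarz[OF A, of "axis l 1" ?x] by simp
    then show ?thesis
      by (simp add: sesqui_axis_left matrix_vector_mult_diff_distrib vector_scalar_commute
          matrix_vector_mult_axis)
  qed
  have kk: "A $ k $ k \<noteq> 0" using k by auto
  have "row l A = (A $ l $ k / A $ k $ k) *s row k A" for l
    using col[of l] kk by (simp add: vec_eq_iff row_def field_simps)
  then have "row l A \<in> vec.span {row k A}" for l
    by (metis vec.span_base vec.span_scale singletonI)
  then have "rows A \<subseteq> vec.span {row k A}"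
    by (auto simp: rows_def)
  moreover have "row k A \<noteq> 0" using kk by (auto simp: row_def vec_eq_iff)
  ultimately have "vec.dim (rows A) = 1"
    by (intro vec.dim_unique[of "{row k A}"]) (auto simp: rows_def)
  then show ?thesis by (simp add: row_rank_def_gen)
qed

text \<open>On Hermitian matrices the trace form is the Euclidean inner product of the type, which
  makes the Cauchy-Schwarz inequality and isometries of real spaces available.\<close>

lemma trace_mult_hermitian:
  fixes A B :: "complex^'n^'n"
  assumes "hermitian A" "hermitian B"
  shows "trace (A ** B) = of_real (A \<bullet> B)"
proof -
  have "Re (trace (A ** B)) = (\<Sum>i\<in>UNIV. \<Sum>j\<in>UNIV. Re (A $ i $ j * cnj (B $ i $ j)))"
    by (simp add: trace_def matrix_matrix_mult_def hermitian_cnj[OF assms(2)])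
  also have "\<dots> = A \<bullet> B"
    by (simp add: inner_vec_def inner_complex_def)
  finally show ?thesis
    using cnj_trace_hermitian[OF assms] by (simp add: complex_eq_iff)
qed

subsection \<open>The measure-and-prepare map\<close>

text \<open>The inequality \<open>ln x \<le> x - 1\<close> is applied to
  \<open>s i / (d + 1)\<close> and to \<open>(d + 1) * r i\<close>; the logarithms cancel in the sum
  because the products are reciprocal. The index \<open>k\<close> is split off since its terms are
  known exactly.\<close>

lemma reciprocal_products_sum_bound:
  fixes r s :: "'m::finite \<Rightarrow> real"
  assumes nn: "\<And>i. 0 \<le> r i" "\<And>i. 0 \<le> s i" and k: "r k = 1" "s k = 1"
    and prod: "(\<Prod>i\<in>UNIV. r i) * (\<Prod>i\<in>UNIV. s i) = 1"
    and sum: "(\<Sum>i\<in>UNIV. r i) \<le> d" and card: "real CARD('m) = d\<^sup>2" and d: "0 \<le> d"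
  shows "1 + (d\<^sup>2 - 1) * (d + 1) \<le> (\<Sum>i\<in>UNIV. s i)"
    and "(\<Sum>i\<in>UNIV. s i) \<le> 1 + (d\<^sup>2 - 1) * (d + 1) \<Longrightarrow> i \<noteq> k \<Longrightarrow> s i = d + 1"
proof -
  let ?c = "d + 1"
  have c: "0 < ?c" using d by simp
  have "(\<Prod>i\<in>UNIV. r i) \<noteq> 0" "(\<Prod>i\<in>UNIV. s i) \<noteq> 0"
    using prod by (metis mult_zero_left mult_zero_right zero_neq_one)+
  then have "r i \<noteq> 0" "s i \<noteq> 0" for i
    using prod_zero[of UNIV r] prod_zero[of UNIV s] by (metis UNIV_I finite)+
  with nn have pos: "0 < r i" "0 < s i" for i by (auto simp: less_le)
  \<comment> \<open>The scale \<open>d + 1\<close> is the extremal value: \<open>g i\<close>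
    vanishes for \<open>s i = d + 1\<close> and \<open>r i = 1 / (d + 1)\<close>.\<close>
  define g where "g i = s i / ?c + ?c * r i - 2 - (ln (s i) + ln (r i))" for i
  have split: "g i = (s i / ?c - 1 - ln (s i / ?c)) + (?c * r i - 1 - ln (?c * r i))" for i
    using pos[of i] c by (simp add: g_def ln_div ln_mult)
  have terms: "0 \<le> s i / ?c - 1 - ln (s i / ?c)" "0 \<le> ?c * r i - 1 - ln (?c * r i)" for i
    using ln_le_minus_one[of "s i / ?c"] ln_le_minus_one[of "?c * r i"] pos[of i] c by auto
  have g: "0 \<le> g i" for i unfolding split using terms[of i] by linarith
  have ln0: "(\<Sum>i\<in>UNIV. ln (s i) + ln (r i)) = 0"
  proof -
    have "(\<Sum>i\<in>UNIV. ln (s i) + ln (r i)) = ln (\<Prod>i\<in>UNIV. s i) + ln (\<Prod>i\<in>UNIV. r i)"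
      using pos by (subst (1 2) ln_prod) (auto simp: sum.distrib less_imp_neq[symmetric])
    also have "\<dots> = ln ((\<Prod>i\<in>UNIV. r i) * (\<Prod>i\<in>UNIV. s i))"
      using pos by (subst ln_mult_pos) (auto intro: prod_pos)
    finally show ?thesis by (simp add: prod)
  qed
  have "(\<Sum>i\<in>UNIV. g i) = (\<Sum>i\<in>UNIV. s i) / ?c + ?c * (\<Sum>i\<in>UNIV. r i) - 2 * d\<^sup>2"
    using ln0 card
    by (simp add: g_def sum_subtractf sum.distrib sum_divide_distrib sum_distrib_left)
  moreover have "(\<Sum>i\<in>UNIV. g i) = g k + (\<Sum>i\<in>UNIV-{k}. g i)"
    by (rule sum.remove) auto
  moreover have "g k = 1 / ?c + ?c - 2"
    by (simp add: g_def k)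
  moreover have "?c * (\<Sum>i\<in>UNIV. r i) \<le> ?c * d"
    using sum c by (intro mult_left_mono) auto
  ultimately have "(\<Sum>i\<in>UNIV-{k}. g i) \<le> (\<Sum>i\<in>UNIV. s i) / ?c - 1 / ?c + ?c * d - ?c + 2 - 2 * d\<^sup>2"
    by linarith
  also have "\<dots> = ((\<Sum>i\<in>UNIV. s i) - (1 + (d\<^sup>2 - 1) * ?c)) / ?c"
  proof -
    have "((\<Sum>i\<in>UNIV. s i) - (1 + (d\<^sup>2 - 1) * ?c)) / ?c = (\<Sum>i\<in>UNIV. s i) / ?c - 1 / ?c - (d\<^sup>2 - 1)"
      using c by (simp add: diff_divide_distrib add_divide_distrib)
    moreover have "?c * d - ?c + 2 - 2 * d\<^sup>2 = - (d\<^sup>2 - 1)"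
      by (simp add: power2_eq_square algebra_simps)
    ultimately show ?thesis by linarith
  qed
  finally have le: "(\<Sum>i\<in>UNIV-{k}. g i) \<le> ((\<Sum>i\<in>UNIV. s i) - (1 + (d\<^sup>2 - 1) * ?c)) / ?c" .
  moreover have "0 \<le> (\<Sum>i\<in>UNIV-{k}. g i)" by (intro sum_nonneg g)
  ultimately have "0 \<le> ((\<Sum>i\<in>UNIV. s i) - (1 + (d\<^sup>2 - 1) * ?c)) / ?c" by (rule order_trans[rotated])
  then show "1 + (d\<^sup>2 - 1) * ?c \<le> (\<Sum>i\<in>UNIV. s i)"
    using c by (simp add: zero_le_divide_iff)
  show "s i = ?c" if s: "(\<Sum>i\<in>UNIV. s i) \<le> 1 + (d\<^sup>2 - 1) * ?c" and "i \<noteq> k"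
  proof -
    have "((\<Sum>i\<in>UNIV. s i) - (1 + (d\<^sup>2 - 1) * ?c)) / ?c \<le> 0"
      using s c by (simp add: divide_le_0_iff)
    with le have "(\<Sum>i\<in>UNIV-{k}. g i) \<le> 0" by linarith
    then have "(\<Sum>i\<in>UNIV-{k}. g i) = 0"
      using sum_nonneg[of "UNIV-{k}" g] g by (intro antisym) auto
    then have "g i = 0" using g \<open>i \<noteq> k\<close> by (simp add: sum_nonneg_eq_0_iff)
    then have "ln (s i / ?c) = s i / ?c - 1"
      using terms[of i] split[of i] by linarith
    then have "s i / ?c = 1" using pos[of i] c by (intro ln_eq_minus_one) auto
    then show ?thesis using c by simp
  qed
qed

section \<open>Traces and norms of MIC elements and states\<close>

lemma hermitian_mat_1: "hermitian (mat 1)"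
  by (auto simp: hermitian_def conj_transpose_def mat_def vec_eq_iff)

lemma mic_hermitian: "mic H \<Longrightarrow> hermitian (H i)"
  by (simp add: mic_def positive_semidefinite_def)

lemma mat_1_inner_hermitian:
  fixes A :: "complex^'n^'n"
  assumes "hermitian A"
  shows "mat 1 \<bullet> A = Re (trace A)"
  using trace_mult_hermitian[OF hermitian_mat_1 assms] by simp

lemma mic_sum_trace:
  fixes H :: "'m::finite \<Rightarrow> complex^'n^'n"
  assumes "mic H"
  shows "(\<Sum>i\<in>UNIV. Re (trace (H i))) = CARD('n)"
proof -
  have "(\<Sum>i\<in>UNIV. Re (trace (H i))) = mat 1 \<bullet> (\<Sum>i\<in>UNIV. H i)"
    by (simp add: inner_sum_right mat_1_inner_hermitian mic_hermitian assms)
  also have "\<dots> = Re (trace (mat 1 :: complex^'n^'n))"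
    using assms by (simp add: mic_def mat_1_inner_hermitian hermitian_mat_1)
  finally show ?thesis by (simp add: trace_I)
qed

lemma density_inner_le:
  assumes "mic H" "density_operator (\<sigma> i)"
  shows "norm (H i) * norm (\<sigma> i) \<le> Re (trace (H i))"
proof -
  have "norm (\<sigma> i) \<le> 1"
    using psd_norm_le_trace[of "\<sigma> i"] assms(2) by (simp add: density_operator_def)
  moreover have "norm (H i) \<le> Re (trace (H i))"
    using assms(1) by (simp add: mic_def psd_norm_le_trace)
  ultimately have "norm (H i) * norm (\<sigma> i) \<le> Re (trace (H i)) * 1"
    using assms(1) by (intro mult_mono psd_trace_nonneg) (auto simp: mic_def)
  then show ?thesis by simp
qed

lemma orthogonal_matrix_norm:
  fixes X :: "real^'m^'m"
  assumes "orthogonal_matrix X"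
  shows "norm (X *v v) = norm v"
  using assms orthogonal_transformation_matrix[of "(*v) X"]
  by (simp add: orthogonal_transformation_norm)

definition overlap_real ::
    "('m::finite \<Rightarrow> complex^'n^'n) \<Rightarrow> ('m \<Rightarrow> complex^'n^'n) \<Rightarrow> real^'m^'m" where
  "overlap_real H \<sigma> = (\<chi> i j. H i \<bullet> \<sigma> j)"

lemma subspace_hermitian: "subspace {A :: complex^'n^'n. hermitian A}"
  by (auto simp: subspace_def hermitian_def conj_transpose_def vec_eq_iff)

text \<open>
  The overlap matrix has the determinant of the trace-preserving map sending \<open>A\<close> to the sum of
  \<open>(H i \<bullet> A) *\<^sub>R \<sigma> i\<close>. Triangularising that map in a basis of Hermitian operators that contains a
  multiple of the identity, the diagonal is dominated by the nuclear norm of the map, which is at most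
  the sum of the \<open>norm (H i) * norm (\<sigma> i)\<close>.
\<close>

lemma overlap_det_diagonal:
  fixes H \<sigma> :: "'m::finite \<Rightarrow> complex^'n^'n" and k :: 'm
  assumes rp: "reference_process H \<sigma>"
  obtains r :: "'m \<Rightarrow> real" where "\<And>i. 0 \<le> r i" "r k = 1" "(\<Sum>i\<in>UNIV. r i) \<le> CARD('n)"
    "(\<Prod>i\<in>UNIV. r i) = \<bar>det (overlap_real H \<sigma>)\<bar>"
proof -
  have mic: "mic H" and dens: "\<And>i. density_operator (\<sigma> i)"
    using rp by (auto simp: reference_process_def)
  let ?S = "{A :: complex^'n^'n. hermitian A}"
  have "dim ?S = card (range H)"
    using mic dim_span_eq_card_independent[of "range H"] by (simp add: mic_def independent_family_def)
  also have "\<dots> = CARD('m)"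
    using mic by (simp add: mic_def independent_family_def card_image)
  finally have dim: "dim ?S = dim (UNIV :: (real^'m) set)" by simp
  \<comment> \<open>The MIC is a basis, so the Hermitian operators form a real space of dimension
    \<open>CARD('m)\<close>; \<open>g\<close> supplies orthonormal coordinates for it.\<close>
  obtain g :: "complex^'n^'n \<Rightarrow> real^'m" where g: "linear g"
    and gn: "\<And>A. hermitian A \<Longrightarrow> norm (g A) = norm A"
    using isometries_subspaces[OF subspace_hermitian subspace_UNIV dim] by (metis mem_Collect_eq)
  have gi: "g A \<bullet> g B = A \<bullet> B" if "hermitian A" "hermitian B" for A B
  proof -
    have "hermitian (A + B)" using subspace_add[OF subspace_hermitian, of A B] that by simp
    then show ?thesis
      by (simp add: dot_norm gn that flip: linear_add[OF g])
  qed
  let ?t = "g (mat 1)"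
  have hs: "hermitian (\<sigma> i)" for i using dens by (rule hermitian_density)
  note hH = mic_hermitian[OF mic]
  have tc: "?t \<bullet> g (\<sigma> i) = 1" for i
    using dens[of i] by (simp add: gi hermitian_mat_1 hs mat_1_inner_hermitian density_operator_def)
  have t_sum: "?t = (\<Sum>i\<in>UNIV. g (H i))"
    using mic linear_sum[OF g, of H UNIV] by (simp add: mic_def)
  have "(norm ?t)\<^sup>2 = CARD('n)"
    unfolding power2_norm_eq_inner
    by (simp add: gi hermitian_mat_1 mat_1_inner_hermitian trace_I)
  then have tn: "norm ?t = sqrt CARD('n)" by (metis norm_ge_zero real_sqrt_unique)
  define u where "u = ?t /\<^sub>R sqrt CARD('n)"
  have "norm u = 1" by (simp add: u_def tn)
  then obtain W :: "real^'m^'m" where W: "orthogonal_matrix W" "W *v axis k 1 = u"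
    using orthogonal_matrix_exists_basis by blast
  \<comment> \<open>In these coordinates \<open>B ** C\<close> is the overlap matrix, while
    \<open>C ** B\<close> is the measure-and-prepare map, with the same determinant. Trace
    preservation says that the transpose \<open>Y\<close> fixes the coordinate vector of the
    identity.\<close>
  define B :: "real^'m^'m" where "B = (\<chi> i j. g (H i) $ j)"
  define C :: "real^'m^'m" where "C = (\<chi> i j. g (\<sigma> j) $ i)"
  define Y where "Y = transpose (C ** B)"
  have M: "overlap_real H \<sigma> = B ** C"
    by (simp add: overlap_real_def B_def C_def matrix_matrix_mult_def vec_eq_iff
        inner_vec_def[of "g _"] flip: gi[OF hH hs])
  have "transpose C *v ?t = (\<chi> i. 1)"
    using tc by (simp add: vec_eq_iff matrix_vector_mult_def transpose_def C_def inner_vec_def mult.commute)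
  moreover have "transpose B *v (\<chi> i. 1) = ?t"
    by (subst t_sum) (simp add: vec_eq_iff matrix_vector_mult_def transpose_def B_def)
  ultimately have "Y *v ?t = ?t"
    by (simp add: Y_def matrix_transpose_mul flip: matrix_vector_mul_assoc)
  then have Yu: "Y *v u = u"
    by (simp add: u_def matrix_vector_mult_scaleR)
  obtain f :: "'m \<Rightarrow> nat" where f: "bij_betw f UNIV {..<CARD('m)}" "f k = 0"
    by (rule enumeration_from)
  obtain X R where X: "orthogonal_matrix X" and "transpose X ** Y = W ** R ** transpose W"
    "\<And>i j. f j < f i \<Longrightarrow> R $ i $ j = 0" and R: "\<And>i. 0 \<le> R $ i $ i" "R $ k $ k = 1"
    "trace (transpose X ** Y) = (\<Sum>i\<in>UNIV. R $ i $ i)" "\<bar>det Y\<bar> = (\<Prod>i\<in>UNIV. R $ i $ i)"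
    by (rule triangular_form_fixing_vector[OF f W Yu]) (rule that)
  \<comment> \<open>Cyclicity turns the trace into a sum over outcomes, to which Cauchy-Schwarz
    applies because \<open>X\<close> preserves norms.\<close>
  have "trace (transpose X ** Y) = trace (transpose (C ** B ** X))"
    by (simp add: Y_def matrix_transpose_mul)
  also have "\<dots> = trace (C ** (B ** X))"
    by (simp add: trace_def transpose_def matrix_mul_assoc)
  also have "\<dots> = trace (B ** (X ** C))"
    by (subst trace_mul_sym) (simp add: matrix_mul_assoc)
  also have "\<dots> = (\<Sum>i\<in>UNIV. g (H i) \<bullet> (X *v g (\<sigma> i)))"
    by (simp add: trace_def B_def C_def matrix_vector_mult_def inner_vec_def
        matrix_matrix_mult_def)
  also have "\<dots> \<le> (\<Sum>i\<in>UNIV. norm (H i) * norm (\<sigma> i))"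
    using norm_cauchy_schwarz[of "g (H _)" "X *v g (\<sigma> _)"]
    by (intro sum_mono) (simp add: orthogonal_matrix_norm X gn hH hs)
  also have "\<dots> \<le> (\<Sum>i\<in>UNIV. Re (trace (H i)))"
    by (intro sum_mono density_inner_le mic dens)
  also have "\<dots> = CARD('n)" by (rule mic_sum_trace[OF mic])
  finally have "(\<Sum>i\<in>UNIV. R $ i $ i) \<le> CARD('n)" by (simp add: R)
  moreover have "(\<Prod>i\<in>UNIV. R $ i $ i) = \<bar>det (overlap_real H \<sigma>)\<bar>"
    by (simp add: M Y_def det_mul mult.commute flip: R(4))
  ultimately show ?thesis using that[of "\<lambda>i. R $ i $ i"] R by blast
qed

subsection \<open>Process matrices\<close>

lemma matrix_inv_eqI:
  fixes A :: "'a::semiring_1^'m^'m"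
  assumes "A ** B = mat 1" "B ** A = mat 1"
  shows "matrix_inv A = B"
proof -
  have "A ** matrix_inv A = mat 1"
    unfolding matrix_inv_def by (rule someI2[of _ B]) (use assms in auto)
  then have "B ** (A ** matrix_inv A) = B" by simp
  then show ?thesis using assms(2) by (simp add: matrix_mul_assoc)
qed

lemma sic_overlap_matrix:
  fixes S :: "'m::finite \<Rightarrow> complex^'n^'n"
  assumes "sic S"
  shows "overlap_matrix S (\<lambda>i. real CARD('n) *\<^sub>R S i) $ i $ j =
    1 / of_nat CARD('n) * ((of_nat CARD('n) * (if i = j then 1 else 0) + 1) / (of_nat CARD('n) + 1))"
proof -
  have "trace (S i ** (real CARD('n) *\<^sub>R S j)) = of_nat CARD('n) * trace (S i ** S j)"
    using trace_mult_sum_scaleR[of "S i" "\<lambda>_. real CARD('n)" S "{j}"]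
    by (simp add: scaleR_conv_of_real)
  then show ?thesis
    using assms by (simp add: overlap_matrix_def sic_def power2_eq_square)
qed

text \<open>With J the all-ones matrix, the overlap matrix is (I + J/d)/(d + 1). Since J has size
  d^2, its square is d^2 J, and the product with (d + 1) I - J/d collapses to I.\<close>

lemma sic_process_matrix:
  fixes S :: "'m::finite \<Rightarrow> complex^'n^'n"
  assumes "sic S"
  shows "process_matrix S (\<lambda>i. real CARD('n) *\<^sub>R S i) =
    (\<chi> i j. (of_nat CARD('n) + 1) * (if i = j then 1 else 0) - 1 / of_nat CARD('n))"
proof -
  let ?d = "of_nat CARD('n) :: complex"
  let ?M = "overlap_matrix S (\<lambda>i. real CARD('n) *\<^sub>R S i)"
  let ?P = "(\<chi> i j. (?d + 1) * (if i = j then 1 else 0) - 1 / ?d) :: complex^'m^'m"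
  have card: "of_nat CARD('m) = ?d\<^sup>2"
    using assms by (simp add: sic_def mic_def)
  have d: "?d \<noteq> 0" "?d + 1 \<noteq> 0"
    using of_nat_neq_0[of "CARD('n)", where 'a = complex] by (auto simp: add.commute)
  have "(?M ** ?P) $ i $ j = (mat 1 :: complex^'m^'m) $ i $ j" for i j
  proof -
    let ?e = "\<lambda>i k :: 'm. if i = k then 1 else 0 :: complex"
    have "(?M ** ?P) $ i $ j = (\<Sum>k\<in>UNIV. 1 / ?d * ((?d * ?e i k + 1) / (?d + 1)) *
        ((?d + 1) * ?e k j - 1 / ?d))"
      by (simp only: matrix_matrix_mult_def sic_overlap_matrix[OF assms] vec_lambda_beta)
    also have "\<dots> = (\<Sum>k\<in>UNIV. ?e i k * ?e k j + ?e k j / ?d - ?e i k / (?d * (?d + 1))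
        - 1 / (?d\<^sup>2 * (?d + 1)))"
      using d by (intro sum.cong refl) (simp add: divide_simps power2_eq_square, simp add: algebra_simps)
    also have "\<dots> = ?e i j + 1 / ?d - 1 / (?d * (?d + 1)) - 1 / (?d + 1)"
      using d by (simp add: sum.distrib sum_subtractf card if_distrib[of "\<lambda>x. x * _"]
          flip: sum_divide_distrib cong: if_cong)
    also have "\<dots> = ?e i j" using d by (simp add: divide_simps) (simp add: algebra_simps)
    finally show ?thesis by (simp add: mat_def)
  qed
  then have "?M ** ?P = mat 1" by (simp add: vec_eq_iff)
  then show ?thesis
    unfolding process_matrix_def by (intro matrix_inv_eqI) (simp_all add: matrix_left_right_inverse)
qed

lemma sic_process_matrix_diff:
  fixes S :: "'m::finite \<Rightarrow> complex^'n^'n"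
  assumes "sic S"
  shows "mat 1 - process_matrix S (\<lambda>i. real CARD('n) *\<^sub>R S i) =
    (\<chi> i j. - of_nat CARD('n) * (centering :: complex^'m^'m) $ i $ j)"
proof -
  have "of_nat CARD('m) = (of_nat CARD('n) :: complex)\<^sup>2"
    using assms by (simp add: sic_def mic_def)
  then show ?thesis
    by (simp add: sic_process_matrix[OF assms] vec_eq_iff mat_def centering_def
        power2_eq_square algebra_simps)
qed

section \<open>Real forms of the overlap and process matrices\<close>

lemma overlap_matrix_eq_real:
  assumes "reference_process H \<sigma>"
  shows "overlap_matrix H \<sigma> $ i $ j = of_real (overlap_real H \<sigma> $ i $ j)"
  using assms
  by (simp add: overlap_matrix_def overlap_real_def trace_mult_hermitian mic_hermitian
      hermitian_density reference_process_def)

definition process_real ::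
    "('m::finite \<Rightarrow> complex^'n^'n) \<Rightarrow> ('m \<Rightarrow> complex^'n^'n) \<Rightarrow> real^'m^'m" where
  "process_real H \<sigma> = (\<chi> i j. Re (process_matrix H \<sigma> $ i $ j))"

lemma process_matrix_eq_real:
  assumes "reference_process H \<sigma>"
  shows "process_matrix H \<sigma> $ i $ j = of_real (process_real H \<sigma> $ i $ j)"
  using process_matrix_column_quasistochastic[OF assms]
  by (simp add: column_quasistochastic_def process_real_def)

lemma process_real_column_sum:
  assumes "reference_process H \<sigma>"
  shows "(\<Sum>i\<in>UNIV. process_real H \<sigma> $ i $ j) = 1"
  using process_matrix_column_quasistochastic[OF assms]
  by (simp add: column_quasistochastic_def process_real_def flip: Re_sum)

lemma overlap_process_real:
  fixes H \<sigma> :: "'m::finite \<Rightarrow> complex^'n^'n"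
  assumes "reference_process H \<sigma>"
  shows "overlap_real H \<sigma> ** process_real H \<sigma> = mat 1"
proof -
  have "of_real ((overlap_real H \<sigma> ** process_real H \<sigma>) $ i $ j) =
      (overlap_matrix H \<sigma> ** process_matrix H \<sigma>) $ i $ j" for i j
    by (simp add: matrix_matrix_mult_def overlap_matrix_eq_real[OF assms]
        process_matrix_eq_real[OF assms])
  then have "complex_of_real ((overlap_real H \<sigma> ** process_real H \<sigma>) $ i $ j) =
      of_real ((mat 1 :: real^'m^'m) $ i $ j)" for i j
    by (simp add: process_matrix_inverse(1)[OF assms] mat_def)
  then show ?thesis by (simp only: of_real_eq_iff) (simp add: vec_eq_iff)
qed

text \<open>Columns summing to 1 mean that the transpose of \<Phi> fixes the uniform vector. Its
  diagonal and the one from \<open>overlap_det_diagonal\<close> have reciprocal products, so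
  \<open>reciprocal_products_sum_bound\<close> applies. The enumeration \<open>f\<close> stays a
  parameter since the equality case uses two of them.\<close>

lemma process_triangular_form:
  fixes H \<sigma> :: "'m::finite \<Rightarrow> complex^'n^'n" and W :: "real^'m^'m" and f :: "'m \<Rightarrow> nat"
  assumes rp: "reference_process H \<sigma>" and f: "bij_betw f UNIV {..<CARD('m)}" "f k = 0"
    and W: "orthogonal_matrix W" "W *v axis k 1 = (\<chi> i. 1 / real CARD('n))"
  obtains X R where "orthogonal_matrix X"
    "transpose X ** transpose (process_real H \<sigma>) = W ** R ** transpose W"
    "\<And>i j. f j < f i \<Longrightarrow> R $ i $ j = 0"
    "trace (process_real H \<sigma> ** X) = (\<Sum>i\<in>UNIV. R $ i $ i)"
    "1 + ((real CARD('n))\<^sup>2 - 1) * (real CARD('n) + 1) \<le> (\<Sum>i\<in>UNIV. R $ i $ i)"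
    "\<And>i. (\<Sum>i\<in>UNIV. R $ i $ i) \<le> 1 + ((real CARD('n))\<^sup>2 - 1) * (real CARD('n) + 1) \<Longrightarrow> i \<noteq> k \<Longrightarrow>
      R $ i $ i = real CARD('n) + 1"
proof -
  let ?P = "process_real H \<sigma>" and ?d = "real CARD('n)"
  have card: "real CARD('m) = ?d\<^sup>2"
    using rp by (simp add: reference_process_def mic_def)
  have "transpose ?P *v (\<chi> i. 1 / ?d) = (\<chi> i. 1 / ?d)"
    using process_real_column_sum[OF rp]
    by (simp add: vec_eq_iff matrix_vector_mult_def transpose_def flip: sum_divide_distrib)
  then obtain X R where X: "orthogonal_matrix X"
    and XR: "transpose X ** transpose ?P = W ** R ** transpose W"
    and tri: "\<And>i j. f j < f i \<Longrightarrow> R $ i $ j = 0" and R: "\<And>i. 0 \<le> R $ i $ i" "R $ k $ k = 1"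
    and tr: "trace (transpose X ** transpose ?P) = (\<Sum>i\<in>UNIV. R $ i $ i)"
    and det: "\<bar>det (transpose ?P)\<bar> = (\<Prod>i\<in>UNIV. R $ i $ i)"
    by (rule triangular_form_fixing_vector[OF f W]) (rule that)
  obtain r :: "'m \<Rightarrow> real" where r: "\<And>i. 0 \<le> r i" "r k = 1" "(\<Sum>i\<in>UNIV. r i) \<le> ?d"
    "(\<Prod>i\<in>UNIV. r i) = \<bar>det (overlap_real H \<sigma>)\<bar>"
    by (rule overlap_det_diagonal[OF rp]) (rule that)
  have "det (overlap_real H \<sigma>) * det ?P = 1"
    using arg_cong[OF overlap_process_real[OF rp], of det] by (simp add: det_mul)
  then have "(\<Prod>i\<in>UNIV. r i) * (\<Prod>i\<in>UNIV. R $ i $ i) = 1"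
    by (simp add: r(4) flip: det abs_mult)
  note bound = reciprocal_products_sum_bound[OF r(1) R(1) r(2) R(2) this r(3) card of_nat_0_le_iff]
  have trP: "trace (?P ** X) = (\<Sum>i\<in>UNIV. R $ i $ i)"
    unfolding tr[symmetric] matrix_transpose_mul[symmetric] by (simp add: trace_def transpose_def)
  show thesis
  proof (rule that[OF X XR _ trP bound(1)])
    show "R $ i $ j = 0" if "f j < f i" for i j using that by (rule tri)
  qed (use bound(2) in blast)+
qed

text \<open>Multiplying I - \<Phi> by \<open>X\<close> on the right keeps the column sums zero and
  leaves \<open>N\<close> unchanged, so \<open>trace_norm_centering_le\<close> applies to the
  product. For a single index \<open>centering\<close> is zero and the first claim is empty; there
  the trace is itself a column sum.\<close>

lemma trace_centering_le:
  fixes H \<sigma> :: "'m::finite \<Rightarrow> complex^'n^'n" and X :: "real^'m^'m"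
  assumes rp: "reference_process H \<sigma>" and N: "unitarily_invariant_norm N"
    and X: "orthogonal_matrix X"
  shows "(trace (process_real H \<sigma> ** X) - trace X) * N (centering :: complex^'m^'m) \<le>
      (real CARD('m) - 1) * N (mat 1 - process_matrix H \<sigma>)"
    and "CARD('m) = 1 \<Longrightarrow> trace (process_real H \<sigma> ** X) = trace X"
proof -
  let ?P = "process_real H \<sigma>"
  let ?Z = "(mat 1 - ?P) ** X"
  let ?A = "mat 1 - process_matrix H \<sigma>"
  let ?Xc = "\<chi> i j. complex_of_real (X $ i $ j)"
  have "?A $ i $ j = of_real ((mat 1 - ?P) $ i $ j)" for i j
    by (simp add: process_matrix_eq_real[OF rp] mat_def)
  then have Z: "(?A ** ?Xc) $ i $ j = of_real (?Z $ i $ j)" for i j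
    unfolding matrix_matrix_mult_def by simp
  have colP: "(\<Sum>i\<in>UNIV. (mat 1 - ?P) $ i $ l) = 0" for l
    by (simp add: sum_subtractf process_real_column_sum[OF rp] mat_def)
  have col: "(\<Sum>i\<in>UNIV. ?Z $ i $ j) = 0" for j
  proof -
    have "(\<Sum>i\<in>UNIV. ?Z $ i $ j) = (\<Sum>l\<in>UNIV. \<Sum>i\<in>UNIV. (mat 1 - ?P) $ i $ l * X $ l $ j)"
      unfolding matrix_matrix_mult_def by (simp only: vec_lambda_beta) (rule sum.swap)
    also have "\<dots> = 0" by (simp only: colP flip: sum_distrib_right) simp
    finally show ?thesis .
  qed
  have trZ: "trace ?Z = trace X - trace (?P ** X)"
  proof -
    have "?Z = X - ?P ** X"
      by (simp add: vec_eq_iff matrix_matrix_mult_def left_diff_distrib sum_subtractf mat_def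
          if_distrib[of "\<lambda>x. x * _"] cong: if_cong)
    then show ?thesis by (simp add: trace_sub)
  qed
  have "(\<Sum>i\<in>UNIV. (?A ** ?Xc) $ i $ j) = 0" for j
    unfolding Z by (simp add: col flip: of_real_sum)
  from trace_norm_centering_le[OF N this]
  have "cmod (trace (?A ** ?Xc)) * N centering \<le> (real CARD('m) - 1) * N ?A"
    by (simp add: unitarily_invariant_norm_mult_orthogonal[OF N X])
  moreover have "trace (?A ** ?Xc) = of_real (trace ?Z)"
    by (simp add: trace_def Z)
  moreover have "(trace (?P ** X) - trace X) * N centering \<le> \<bar>trace ?Z\<bar> * N (centering :: complex^'m^'m)"
    using N trZ by (intro mult_right_mono) (auto simp: unitarily_invariant_norm_def matrix_norm_def)
  ultimately show "(trace (?P ** X) - trace X) * N (centering :: complex^'m^'m) \<le>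
      (real CARD('m) - 1) * N ?A"
    by simp
  assume "CARD('m) = 1"
  then obtain a where a: "(UNIV :: 'm set) = {a}" by (rule card_1_singletonE)
  have "trace ?Z = (\<Sum>i\<in>UNIV. ?Z $ i $ a)" by (simp add: trace_def a)
  then show "trace (?P ** X) = trace X" using col trZ by simp
qed

lemma centering_norm_pos:
  assumes "matrix_norm N" "CARD('m) > 1"
  shows "0 < N (centering :: complex^'m^'m)"
proof -
  have "centering $ i $ i \<noteq> (0 :: complex)" for i :: 'm
    using assms(2) by (simp add: centering_def)
  then have "(centering :: complex^'m^'m) \<noteq> 0" by (auto simp: vec_eq_iff)
  then show ?thesis using assms(1) by (auto simp: matrix_norm_def less_le)
qed

lemma uniform_vector_basis:
  assumes "CARD('m::finite) = CARD('n::finite)\<^sup>2"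
  obtains W :: "real^'m^'m" where "orthogonal_matrix W"
    "W *v axis k 1 = (\<chi> i. 1 / real CARD('n))"
proof -
  have "norm (\<chi> i::'m. 1 / real CARD('n)) = 1"
    using assms by (simp add: norm_vec_def L2_set_def power_divide)
  then show thesis using orthogonal_matrix_exists_basis that by blast
qed

lemma process_norm_ge:
  fixes H \<sigma> :: "'m::finite \<Rightarrow> complex^'n^'n"
  assumes rp: "reference_process H \<sigma>" and N: "unitarily_invariant_norm N"
  shows "real CARD('n) * N (centering :: complex^'m^'m) \<le> N (mat 1 - process_matrix H \<sigma>)"
proof -
  let ?d = "real CARD('n)" and ?C = "centering :: complex^'m^'m"
  let ?A = "mat 1 - process_matrix H \<sigma>"
  have mn: "matrix_norm N" using N by (simp add: unitarily_invariant_norm_def)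
  have m: "CARD('m) = CARD('n)\<^sup>2" using rp by (simp add: reference_process_def mic_def)
  then have card: "real CARD('m) = ?d\<^sup>2" by simp
  show ?thesis
  proof (cases "CARD('m) = 1")
    case True
    then obtain a where a: "(UNIV :: 'm set) = {a}" by (rule card_1_singletonE)
    have "?C $ i $ j = 0" for i j
    proof -
      have "i = a" "j = a" using a by blast+
      then show ?thesis using True by (simp add: centering_def)
    qed
    then have "?C = 0" by (simp add: vec_eq_iff)
    then have "N ?C = 0" using matrix_norm_zero[OF mn] by simp
    moreover have "0 \<le> N ?A" using mn unfolding matrix_norm_def by blast
    ultimately show ?thesis by simp
  next
    case False
    then have n: "0 < real CARD('m) - 1" using zero_less_card_finite[where 'a = 'm] by linarith
    obtain k :: 'm where True by simp
    obtain f where f: "bij_betw f UNIV {..<CARD('m)}" "f k = 0"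
      by (rule enumeration_from)
    obtain W :: "real^'m^'m" where W: "orthogonal_matrix W"
      "W *v axis k 1 = (\<chi> i. 1 / ?d)"
      by (rule uniform_vector_basis[OF m])
    obtain X R where X: "orthogonal_matrix X"
      and "transpose X ** transpose (process_real H \<sigma>) = W ** R ** transpose W"
      and "\<And>i j. f j < f i \<Longrightarrow> R $ i $ j = 0"
      and tr: "trace (process_real H \<sigma> ** X) = (\<Sum>i\<in>UNIV. R $ i $ i)"
      and lb: "1 + (?d\<^sup>2 - 1) * (?d + 1) \<le> (\<Sum>i\<in>UNIV. R $ i $ i)"
      and "\<And>i. (\<Sum>i\<in>UNIV. R $ i $ i) \<le> 1 + (?d\<^sup>2 - 1) * (?d + 1) \<Longrightarrow> i \<noteq> k \<Longrightarrow>
        R $ i $ i = ?d + 1"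
      by (rule process_triangular_form[OF rp f W]) (rule that)
    \<comment> \<open>The trace of \<open>X\<close> is at most d^2, and 1 + (d^2 - 1)(d + 1) - d^2 =
      (d^2 - 1) d.\<close>
    have "(real CARD('m) - 1) * ?d \<le> trace (process_real H \<sigma> ** X) - trace X"
      using lb tr card orthogonal_matrix_trace_le[OF X] by (simp add: algebra_simps)
    then have "(real CARD('m) - 1) * ?d * N ?C \<le> (trace (process_real H \<sigma> ** X) - trace X) * N ?C"
      using mn by (intro mult_right_mono) (auto simp: matrix_norm_def)
    also have "\<dots> \<le> (real CARD('m) - 1) * N ?A"
      by (rule trace_centering_le[OF rp N X])
    finally show ?thesis using n by (simp add: mult.assoc)
  qed
qed

subsection \<open>The case of equality\<close>

text \<open>Equality forces \<open>X\<close> to be the identity, so the transpose of \<Phi>, in the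
  basis \<open>W\<close>, is itself triangular for every enumeration starting at \<open>k\<close>.
  Two opposite enumerations leave only row \<open>k\<close> undetermined, and that row becomes the
  vector \<open>a\<close>.\<close>

lemma process_norm_extremal_form:
  fixes H \<sigma> :: "'m::finite \<Rightarrow> complex^'n^'n"
  assumes rp: "reference_process H \<sigma>" and N: "unitarily_invariant_norm N"
    and eq: "N (mat 1 - process_matrix H \<sigma>) \<le> real CARD('n) * N (centering :: complex^'m^'m)"
  obtains a where "\<And>i j. process_real H \<sigma> $ i $ j = (if i = j then real CARD('n) + 1 else 0) + a i"
proof -
  let ?d = "real CARD('n)" and ?C = "centering :: complex^'m^'m"
  let ?P = "process_real H \<sigma>"
  have mn: "matrix_norm N" using N by (simp add: unitarily_invariant_norm_def)
  have m: "CARD('m) = CARD('n)\<^sup>2" using rp by (simp add: reference_process_def mic_def)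
  then have card: "real CARD('m) = ?d\<^sup>2" by simp
  have ub: "trace (?P ** X) - trace X \<le> (?d\<^sup>2 - 1) * ?d" if X: "orthogonal_matrix X" for X
  proof (cases "CARD('m) = 1")
    case True
    then show ?thesis using trace_centering_le(2)[OF rp N X] card by simp
  next
    case False
    then have m1: "CARD('m) > 1" using zero_less_card_finite[where 'a = 'm] by linarith
    have "(trace (?P ** X) - trace X) * N ?C \<le> (real CARD('m) - 1) * N (mat 1 - process_matrix H \<sigma>)"
      by (rule trace_centering_le[OF rp N X])
    also have "\<dots> \<le> (real CARD('m) - 1) * (?d * N ?C)"
      using m1 eq by (intro mult_left_mono) auto
    finally show ?thesis
      using centering_norm_pos[OF mn m1] by (simp add: card flip: mult.assoc)
  qed
  obtain k :: 'm where True by simp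
  obtain f where f: "bij_betw f UNIV {..<CARD('m)}" "f k = 0"
    by (rule enumeration_from)
  obtain W :: "real^'m^'m" where W: "orthogonal_matrix W" "W *v axis k 1 = (\<chi> i. 1 / ?d)"
    by (rule uniform_vector_basis[OF m])
  define R where "R = transpose W ** transpose ?P ** W"
  have key: "(f j < f i \<longrightarrow> R $ i $ j = 0) \<and> (i \<noteq> k \<longrightarrow> R $ i $ i = ?d + 1)"
    if f: "bij_betw f UNIV {..<CARD('m)}" "f k = 0" for f i j
  proof -
    obtain X R' where X: "orthogonal_matrix X"
      and XR: "transpose X ** transpose ?P = W ** R' ** transpose W"
      and tri: "\<And>i j. f j < f i \<Longrightarrow> R' $ i $ j = 0"
      and tr: "trace (?P ** X) = (\<Sum>i\<in>UNIV. R' $ i $ i)"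
      and lb: "1 + (?d\<^sup>2 - 1) * (?d + 1) \<le> (\<Sum>i\<in>UNIV. R' $ i $ i)"
      and diag: "\<And>i. (\<Sum>i\<in>UNIV. R' $ i $ i) \<le> 1 + (?d\<^sup>2 - 1) * (?d + 1) \<Longrightarrow> i \<noteq> k \<Longrightarrow>
        R' $ i $ i = ?d + 1"
      by (rule process_triangular_form[OF rp f W]) (rule that)
    \<comment> \<open>The lower bound on the trace of the product and the upper bound
      \<open>ub\<close> leave at least d^2 for the trace of \<open>X\<close>.\<close>
    have "real CARD('m) \<le> trace X"
      using lb ub[OF X] tr card by (simp add: algebra_simps)
    with X have X1: "X = mat 1" by (rule orthogonal_matrix_trace_eq)
    then have "trace X = ?d\<^sup>2" by (simp add: trace_I m)
    then have "(\<Sum>i\<in>UNIV. R' $ i $ i) \<le> 1 + (?d\<^sup>2 - 1) * (?d + 1)"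
      using ub[OF X] tr by (simp add: algebra_simps)
    moreover have "R' = transpose W ** (W ** R' ** transpose W) ** W"
      by (simp add: matrix_mul_assoc orthogonal_matrixD[OF W(1)])
        (simp add: orthogonal_matrixD[OF W(1)] flip: matrix_mul_assoc)
    then have "R' = R" using XR X1 by (simp add: R_def)
    ultimately show ?thesis using tri diag by blast
  qed
  \<comment> \<open>The opposite enumeration: \<open>k\<close> stays first and all other indices are
    reversed. Any \<open>j\<close> different from \<open>i\<close> precedes \<open>i\<close> in one
    of the two orders, provided that \<open>i\<close> is not \<open>k\<close>.\<close>
  define f' where "f' i = (if i = k then 0 else CARD('m) - f i)" for i
  have fi: "inj f" and fr: "range f = {..<CARD('m)}"
    using f by (auto simp: bij_betw_def)
  then have fl: "f i < CARD('m)" for i by auto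
  have f0: "f i = 0 \<longleftrightarrow> i = k" for i using fi f(2) by (metis injD)
  have "inj f'"
  proof (rule injI)
    fix i j assume eq: "f' i = f' j"
    have "i = k \<longleftrightarrow> j = k" using eq fl[of i] fl[of j] by (auto simp: f'_def split: if_splits)
    moreover have "f i = f j" if "i \<noteq> k" "j \<noteq> k"
      using eq that fl[of i] fl[of j] by (simp add: f'_def)
    ultimately show "i = j" using fi by (metis injD)
  qed
  moreover have "range f' \<subseteq> {..<CARD('m)}"
  proof -
    have "f' i < CARD('m)" for i using fl[of i] f0[of i] by (auto simp: f'_def)
    then show ?thesis by auto
  qed
  ultimately have f': "bij_betw f' UNIV {..<CARD('m)}"
    by (intro bij_betw_imageI card_subset_eq) (auto simp: card_image)
  have off: "R $ i $ j = (if i = j then ?d + 1 else 0)" if "i \<noteq> k" for i j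
  proof -
    have "f j < f i \<or> f' j < f' i" if "i \<noteq> j"
    proof -
      have "f i \<noteq> f j" using fi that by (metis injD)
      then show ?thesis
        using \<open>i \<noteq> k\<close> f0[of j] f0[of i] fl[of i] fl[of j] by (cases "j = k") (auto simp: f'_def)
    qed
    then show ?thesis
      using key[OF f, of j i] key[OF f', of j i] that by (auto simp: f'_def)
  qed
  have W1: "W $ i $ k = 1 / ?d" for i
    using W(2) by (simp add: matrix_vector_mult_axis vec_eq_iff)
  \<comment> \<open>Row \<open>k\<close> of \<open>R\<close>, less its part in (d + 1) I, carried
    back by \<open>W\<close>. As column \<open>k\<close> of \<open>W\<close> is constant, this
    correction does not depend on the column index of \<Phi>.\<close>
  define v where "v j = (\<Sum>l\<in>UNIV. (R $ k $ l - (if k = l then ?d + 1 else 0)) * W $ j $ l)" for j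
  have "transpose ?P = W ** R ** transpose W"
    unfolding R_def
    by (simp add: matrix_mul_assoc orthogonal_matrixD[OF W(1)])
      (simp add: orthogonal_matrixD[OF W(1)] flip: matrix_mul_assoc)
  then have P: "?P $ j $ i = (\<Sum>l\<in>UNIV. (\<Sum>q\<in>UNIV. W $ i $ q * R $ q $ l) * W $ j $ l)" for i j
    by (simp add: vec_eq_iff matrix_matrix_mult_def transpose_def)
  have WR: "(\<Sum>q\<in>UNIV. W $ i $ q * R $ q $ l) =
      (?d + 1) * W $ i $ l + 1 / ?d * (R $ k $ l - (if k = l then ?d + 1 else 0))" for i l
  proof -
    have "(\<Sum>q\<in>UNIV. W $ i $ q * R $ q $ l) = (\<Sum>q\<in>UNIV. (if q = l then W $ i $ q * (?d + 1) else 0) +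
        (if q = k then W $ i $ q * (R $ k $ l - (if k = l then ?d + 1 else 0)) else 0))"
      by (intro sum.cong refl) (auto simp: off algebra_simps)
    also have "\<dots> = (?d + 1) * W $ i $ l + 1 / ?d * (R $ k $ l - (if k = l then ?d + 1 else 0))"
      by (simp add: sum.distrib W1 mult.commute)
    finally show ?thesis .
  qed
  have WW: "(\<Sum>l\<in>UNIV. W $ i $ l * W $ j $ l) = (if i = j then 1 else 0)" for i j
    using orthogonal_matrixD(2)[OF W(1)]
    by (simp add: vec_eq_iff matrix_matrix_mult_def transpose_def mat_def)
  have "?P $ j $ i = (if j = i then ?d + 1 else 0) + v j / ?d" for i j
  proof -
    have "?P $ j $ i = (?d + 1) * (\<Sum>l\<in>UNIV. W $ i $ l * W $ j $ l) + 1 / ?d * v j"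
      unfolding P WR v_def by (simp only: distrib_right sum.distrib sum_distrib_left mult.assoc)
    then show ?thesis by (simp add: WW)
  qed
  then show thesis by (rule that)
qed

lemma overlap_real_column_sum:
  assumes "reference_process H \<sigma>"
  shows "(\<Sum>i\<in>UNIV. overlap_real H \<sigma> $ i $ j) = 1"
proof -
  have d: "density_operator (\<sigma> j)" and s: "(\<Sum>i\<in>UNIV. H i) = mat 1"
    using assms by (auto simp: reference_process_def mic_def)
  have "(\<Sum>i\<in>UNIV. overlap_real H \<sigma> $ i $ j) = mat 1 \<bullet> \<sigma> j"
    by (simp add: overlap_real_def flip: inner_sum_left s)
  then show ?thesis
    using d by (simp add: mat_1_inner_hermitian hermitian_density density_operator_def)
qed

text \<open>Inverting \<Phi> shows that the overlap matrix is I/(d + 1) plus a matrix with equal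
  columns, and unit column sums fix its trace as d. This is the largest value that Cauchy-Schwarz
  and \<open>psd_norm_le_trace\<close> allow, so all these estimates are equalities.\<close>

lemma extremal_process_sic:
  fixes H \<sigma> :: "'m::finite \<Rightarrow> complex^'n^'n"
  assumes rp: "reference_process H \<sigma>"
    and P: "\<And>i j. process_real H \<sigma> $ i $ j = (if i = j then real CARD('n) + 1 else 0) + a i"
  shows "sic H \<and> (\<forall>i. \<sigma> i = real CARD('n) *\<^sub>R H i)"
proof -
  let ?d = "real CARD('n)" and ?M = "overlap_real H \<sigma>"
  have mic: "mic H" and dens: "\<And>i. density_operator (\<sigma> i)"
    using rp by (auto simp: reference_process_def)
  have card: "real CARD('m) = ?d\<^sup>2" using mic by (simp add: mic_def)
  have d: "0 < ?d" by simp
  define b where "b i = - (\<Sum>l\<in>UNIV. ?M $ i $ l * a l) / (?d + 1)" for i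
  have M: "?M $ i $ j = (if i = j then 1 / (?d + 1) else 0) + b i" for i j
  proof -
    have "(\<Sum>l\<in>UNIV. ?M $ i $ l * ((if l = j then ?d + 1 else 0) + a l)) = (if i = j then 1 else 0)"
      using overlap_process_real[OF rp] by (simp add: vec_eq_iff matrix_matrix_mult_def mat_def P)
    then have "?M $ i $ j * (?d + 1) + (\<Sum>l\<in>UNIV. ?M $ i $ l * a l) = (if i = j then 1 else 0)"
      by (simp add: distrib_left sum.distrib if_distrib[of "\<lambda>x. _ * x"] cong: if_cong)
    then show ?thesis using d by (simp add: b_def field_simps split: if_splits)
  qed
  have sb: "(\<Sum>i\<in>UNIV. b i) = ?d / (?d + 1)"
    using overlap_real_column_sum[OF rp] d by (simp add: M sum.distrib field_simps)
  have trM: "(\<Sum>i\<in>UNIV. ?M $ i $ i) = ?d"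
  proof -
    have "(\<Sum>i\<in>UNIV. ?M $ i $ i) = ?d\<^sup>2 / (?d + 1) + ?d / (?d + 1)"
      by (simp add: M sum.distrib sb card)
    also have "\<dots> = ?d * (?d + 1) / (?d + 1)"
      by (simp add: power2_eq_square distrib_left add_divide_distrib)
    also have "\<dots> = ?d" using d by simp
    finally show ?thesis .
  qed
  define h where "h i = Re (trace (H i))" for i
  have sh: "(\<Sum>i\<in>UNIV. h i) = ?d" unfolding h_def by (rule mic_sum_trace[OF mic])
  \<comment> \<open>Both ends of the chain have sum d over \<open>i\<close>, so each inequality in
    it is an equality.\<close>
  have chain: "?M $ i $ i \<le> norm (H i) * norm (\<sigma> i)" "norm (H i) * norm (\<sigma> i) \<le> h i" for i
    using norm_cauchy_schwarz[of "H i" "\<sigma> i"] density_inner_le[OF mic dens]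
    by (auto simp: overlap_real_def h_def)
  have "(\<Sum>i\<in>UNIV. h i - ?M $ i $ i) = 0"
    by (simp add: sum_subtractf sh trM)
  moreover have "0 \<le> h i - ?M $ i $ i" for i using chain[of i] by linarith
  ultimately have Mh: "?M $ i $ i = h i" for i by (simp add: sum_nonneg_eq_0_iff)
  have Hn: "norm (H i) \<le> h i" for i
    using mic by (simp add: h_def mic_def psd_norm_le_trace)
  have sn: "norm (\<sigma> i) \<le> 1" for i
    using psd_norm_le_trace[of "\<sigma> i"] dens[of i] by (simp add: density_operator_def)
  have H0: "H i \<noteq> 0" for i
    using mic dependent_zero[of "range H"] by (metis mic_def independent_family_def rangeI)
  then have hp: "0 < h i" for i using Hn[of i] by (simp add: less_le_trans[of 0 "norm (H i)"])
  have prod: "norm (H i) * norm (\<sigma> i) = h i" for i using chain[of i] Mh[of i] by linarith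
  have "h i \<le> norm (H i)" for i
    using prod[of i] mult_left_le[OF sn[of i] norm_ge_zero[of "H i"]] by linarith
  with Hn have nH: "norm (H i) = h i" for i by (intro antisym) auto
  with prod hp have ns: "norm (\<sigma> i) = 1" for i by (metis less_numeral_extra(3) mult_cancel_left1)
  have s: "\<sigma> i = (1 / h i) *\<^sub>R H i" for i
  proof -
    have "H i \<bullet> \<sigma> i = norm (H i) * norm (\<sigma> i)"
      using Mh[of i] prod[of i] by (simp add: overlap_real_def)
    then have "norm (H i) *\<^sub>R \<sigma> i = norm (\<sigma> i) *\<^sub>R H i"
      by (rule norm_cauchy_schwarz_eq[THEN iffD1])
    then have "h i *\<^sub>R \<sigma> i = H i" by (simp add: nH ns)
    then have "(1 / h i) *\<^sub>R H i = (1 / h i) *\<^sub>R (h i *\<^sub>R \<sigma> i)" by simp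
    then show ?thesis using hp[of i] by simp
  qed
  have M': "?M $ i $ j * h j = H i \<bullet> H j" for i j
    using hp[of j] by (simp add: overlap_real_def s[of j])
  \<comment> \<open>With \<open>\<sigma> j\<close> proportional to \<open>H j\<close>, the symmetry
    of the inner product makes \<open>b\<close> proportional to \<open>h\<close>; the known sums
    then fix the factor.\<close>
  have bh: "b i * h j = b j * h i" for i j
  proof (cases "i = j")
    case False
    then show ?thesis using M'[of i j] M'[of j i] by (simp add: M inner_commute)
  qed simp
  have b: "b i = h i / (?d + 1)" for i
  proof -
    have "b i * ?d = (\<Sum>j\<in>UNIV. b j * h i)"
      by (simp add: bh[of _ i] sum_distrib_left flip: sh bh[of i])
    also have "\<dots> = ?d / (?d + 1) * h i" by (simp add: sb flip: sum_distrib_right)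
    also have "\<dots> = h i / (?d + 1) * ?d" by simp
    finally show ?thesis using d by (simp only: mult_right_cancel[OF less_imp_neq[OF d, symmetric]])
  qed
  \<comment> \<open>The diagonal entry \<open>h i\<close> equals
    \<open>1 / (d + 1) + h i / (d + 1)\<close>, which has this single solution.\<close>
  have h: "h i = 1 / ?d" for i
    using Mh[of i] d by (simp add: M b field_simps)
  have inner: "H i \<bullet> H j = 1 / ?d\<^sup>2 * ((?d * (if i = j then 1 else 0) + 1) / (?d + 1))" for i j
  proof -
    have "((if i = j then 1 / (x + 1) else 0) + 1 / x / (x + 1)) * (1 / x) =
        1 / x\<^sup>2 * ((x * (if i = j then 1 else 0) + 1) / (x + 1))" if "0 < x" for x :: real
    proof (cases "i = j")
      case True
      have "1 / (x + 1) + 1 / x / (x + 1) = 1 / x" using that by (simp add: divide_simps)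
      then show ?thesis using True that by (simp add: power2_eq_square)
    next
      case False
      then show ?thesis by (simp add: power2_eq_square mult.commute)
    qed
    from this[OF d] show ?thesis unfolding M'[symmetric] M b h .
  qed
  have "trace (H i ** H j) = 1 / (of_nat CARD('n))\<^sup>2 *
      ((of_nat CARD('n) * (if i = j then 1 else 0) + 1) / (of_nat CARD('n) + 1))" for i j
    by (simp add: trace_mult_hermitian mic_hermitian[OF mic] inner)
  moreover have "rank (H i) = 1" for i
    using mic H0 nH by (intro psd_rank_1) (auto simp: mic_def h_def)
  ultimately have "sic H" using mic by (simp add: sic_def)
  then show ?thesis using s h by simp
qed

theorem theorem1:
  fixes H \<sigma> S :: "'m::finite \<Rightarrow> complex^'n^'n"
    and N :: "complex^'m^'m \<Rightarrow> real"
  defines "\<Phi> \<equiv> process_matrix H \<sigma>"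
    and "\<Phi>_SIC \<equiv> process_matrix S (\<lambda>i. real CARD('n) *\<^sub>R S i)"
  assumes "sic S"
    and "reference_process H \<sigma>"
    and "unitarily_invariant_norm N"
  shows "N (mat 1 - \<Phi>) \<ge> N (mat 1 - \<Phi>_SIC) \<and>
    (N (mat 1 - \<Phi>) = N (mat 1 - \<Phi>_SIC) \<longleftrightarrow>
      sic H \<and> (\<forall>i. \<sigma> i = real CARD('n) *\<^sub>R H i))"
proof -
  let ?C = "centering :: complex^'m^'m"
  have mn: "matrix_norm N"
    using assms(5) by (simp add: unitarily_invariant_norm_def)
  \<comment> \<open>Stated for any SIC: \<open>S\<close> gives the value of the bound, and
    \<open>H\<close> gives the direction from the SIC condition to equality.\<close>
  have NS: "N (mat 1 - process_matrix T (\<lambda>i. real CARD('n) *\<^sub>R T i)) = real CARD('n) * N ?C"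
    if "sic T" for T :: "'m \<Rightarrow> complex^'n^'n"
    using mn unfolding sic_process_matrix_diff[OF that] matrix_norm_def
    by (simp only: norm_minus_cancel norm_of_nat)
  have "sic H \<and> (\<forall>i. \<sigma> i = real CARD('n) *\<^sub>R H i)"
    if "N (mat 1 - \<Phi>) \<le> real CARD('n) * N ?C"
    using process_norm_extremal_form[OF assms(4,5)] extremal_process_sic[OF assms(4)] that
    unfolding \<Phi>_def by metis
  moreover have "N (mat 1 - \<Phi>) = real CARD('n) * N ?C"
    if "sic H" "\<forall>i. \<sigma> i = real CARD('n) *\<^sub>R H i"
  proof -
    have "\<sigma> = (\<lambda>i. real CARD('n) *\<^sub>R H i)" using that(2) by blast
    then show ?thesis using NS[OF that(1)] by (simp add: \<Phi>_def)
  qed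
  moreover have "real CARD('n) * N ?C \<le> N (mat 1 - \<Phi>)"
    unfolding \<Phi>_def by (rule process_norm_ge[OF assms(4,5)])
  moreover have "N (mat 1 - \<Phi>_SIC) = real CARD('n) * N ?C"
    unfolding \<Phi>_SIC_def by (rule NS[OF assms(3)])
  ultimately show ?thesis by auto
qed

end
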